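(* There is an absolute constant $C>0$ such that the following holds. Let $n,k$ be integers with $2 \le k \le n-2$, let $p = \min(k/n, 1-k/n)$, and let $f\colon \binom{[n]}{k} \to \{0,1\}$. Suppose there are reals $c_1,\ldots,c_n$ such that $\|f - \ell\|^2 \le \epsilon$, where $\ell(x) = \sum_{i=1}^n c_i x_i$. Then there is a set $S \subseteq [n]$ with $|S| \le \max(1, C\sqrt{\epsilon}/p)$ such that either $f$ or $1-f$ satisfies $\|\,\cdot - g\|^2 \le C\epsilon$, where $g(x) = \max_{i \in S} x_i$ if $k \le n/2$, and $g(x) = \min_{i \in S} x_i$ if $k \ge n/2$.
   Context: The slice is $\binom{[n]}{k} = \{x \in \{0,1\}^n : \sum_i x_i = k\}$, equipped with the uniform probability measure; $\|h\|^2 = \mathbb{E}[h^2]$ under this measure. By convention $\max_{i\in\emptyset} x_i = 0$ and $\min_{i \in \emptyset} x_i = 1$. Every affine function on the slice can be written as $\sum_i c_i x_i$. *)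

theory Defs
  imports "HOL-Probability.Probability"
begin

definition slice :: "nat \<Rightarrow> nat \<Rightarrow> (nat \<Rightarrow> real) set" where
  "slice n k = {x \<in> {1..n} \<rightarrow>\<^sub>E {0, 1}. (\<Sum>i=1..n. x i) = real k}"

text \<open>\<open>pmf_of_set\<close> is only meaningful on finite nonempty sets, and the slice is one
  whenever \<open>k \<le> n\<close>.\<close>

lemma finite_slice [simp]: "finite (slice n k)"
  unfolding slice_def by (rule finite_subset[of _ "{1..n} \<rightarrow>\<^sub>E {0, 1}"]) (auto intro: finite_PiE)

lemma slice_nonempty:
  assumes "k \<le> n"
  shows "slice n k \<noteq> {}"
proof -
  have "(\<Sum>i=1..n. if i \<le> k then 1 else (0::real)) = real k"
  proof -
    have "{1..n} \<inter> {i. i \<le> k} = {1..k}" using assms by auto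
    then show ?thesis by (simp add: sum.If_cases)
  qed
  then have "restrict (\<lambda>i. if i \<le> k then 1 else 0) {1..n} \<in> slice n k"
    unfolding slice_def by auto
  then show ?thesis by blast
qed

definition slice_sqnorm :: "nat \<Rightarrow> nat \<Rightarrow> ((nat \<Rightarrow> real) \<Rightarrow> real) \<Rightarrow> real" where
  "slice_sqnorm n k h = measure_pmf.expectation (pmf_of_set (slice n k)) (\<lambda>x. (h x)\<^sup>2)"

definition max_coord :: "nat set \<Rightarrow> (nat \<Rightarrow> real) \<Rightarrow> real" where
  "max_coord S x = (if S = {} then 0 else Max (x ` S))"

definition min_coord :: "nat set \<Rightarrow> (nat \<Rightarrow> real) \<Rightarrow> real" where
  "min_coord S x = (if S = {} then 1 else Min (x ` S))"

end

theory Submission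
  imports Defs
begin

text \<open>By complementing we may assume \<open>k \<le> n/2\<close>. Composing with products of disjoint transpositions
  embeds cubes into the slice, and a Boolean function on a cube close to an affine one has
  coefficients close to \<open>{-1, 0, 1}\<close> in the square sum sense. Averaging over sufficiently many
  such cubes, all differences \<open>c i - c j\<close> are on average close to \<open>{-1, 0, 1}\<close>, so up to \<open>O(\<epsilon>)\<close> the
  affine function may be replaced by one with integer values, and then \<open>f\<close> agrees with it except
  with probability \<open>O(\<epsilon>)\<close>. An integer-valued affine function that is Boolean with probability close
  to \<open>1\<close> has, after a shift, coefficient \<open>0\<close> on all but \<open>O(1/p)\<close> coordinates; hence all exceptional
  coordinates vanish with probability bounded below. Conditioning on all but one or two of them
  vanishing bounds the number of coefficients different from \<open>0, 1\<close> by \<open>O(\<epsilon>/p)\<close> and the number of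
  coefficients \<open>1\<close> by \<open>max 1 (O(sqrt \<epsilon>/p))\<close>.\<close>

section \<open>Nearly affine Boolean functions on the cube\<close>

text \<open>Adding one number to all \<open>c i\<close> only adds a constant on the slice, so
  nothing beyond the differences \<open>c i - c j\<close> can be controlled, and a common centre
  \<open>z\<close> has to be found. A cube is useful because it bounds the whole sum of
  \<open>dist3\<close> over its directions, not just each term. Over a random point of the slice the
  direction \<open>(i j)\<close> is active with probability \<open>2k(n-k)/(n(n-1))\<close>. Up to
  the factor 2 this is also the weight in the variance of a linear function, so rounding costs
  \<open>O(\<epsilon>)\<close> without a factor \<open>1/p\<close>. The same invariance is why the
  minority coefficients are bounded before the variance is used: the variance controls the number of
  nonzero coefficients only once these are known to be a small fraction of all. It is then at least
  a constant times \<open>p\<close> times their number, whereas a nearly Boolean function has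
  bounded variance; this gives \<open>O(1/p)\<close>. The square root arises because two
  coefficients \<open>1\<close> are needed to leave \<open>{0, 1}\<close>, an event of probability
  about \<open>p^2\<close> per pair, against \<open>p\<close> for one exceptional
  coefficient.\<close>

definition dist3 :: "real \<Rightarrow> real" where
  "dist3 u = min (u\<^sup>2) (min ((u - 1)\<^sup>2) ((u + 1)\<^sup>2))"

lemma dist3_nonneg: "0 \<le> dist3 u"
  by (simp add: dist3_def)

lemma dist3_minus [simp]: "dist3 (- u) = dist3 u"
proof -
  have "(- u - 1)\<^sup>2 = (u + 1)\<^sup>2" "(- u + 1)\<^sup>2 = (u - 1)\<^sup>2"
    by (simp_all add: power2_eq_square algebra_simps)
  then show ?thesis by (simp add: dist3_def min.commute)
qed

lemma dist3_le_square: "dist3 u \<le> u\<^sup>2"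
  by (simp add: dist3_def)

lemma dist3_le: "v \<in> {- 1, 0, 1} \<Longrightarrow> dist3 u \<le> (u - v)\<^sup>2"
  by (auto simp: dist3_def)

lemma dist3_attained: obtains v where "v \<in> {- 1, 0, 1}" "(u - v)\<^sup>2 = dist3 u"
  unfolding dist3_def min_def by (force split: if_splits)

lemma dist3_eq_square: "\<bar>u\<bar> \<le> 1 / 2 \<Longrightarrow> dist3 u = u\<^sup>2"
  by (auto simp: dist3_def min_def power2_eq_square algebra_simps abs_le_iff)

text \<open>A polynomial minorant, so that second and fourth moments suffice to bound a mean of
  \<open>dist3\<close> from below. It is nonpositive beyond 1/2, and up to 1/2 the nearest point is
  0.\<close>

lemma dist3_ge: "u\<^sup>2 - 4 * u ^ 4 \<le> dist3 u"
proof (cases "\<bar>u\<bar> \<le> 1 / 2")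
  case True
  then show ?thesis by (simp add: dist3_eq_square)
next
  case False
  then have "(1 / 2)\<^sup>2 \<le> \<bar>u\<bar>\<^sup>2" by (intro power_mono) auto
  then have "1 \<le> 4 * u\<^sup>2" by (simp add: power2_eq_square)
  then have "u\<^sup>2 * 1 \<le> u\<^sup>2 * (4 * u\<^sup>2)" by (intro mult_left_mono) auto
  then have "u\<^sup>2 \<le> 4 * u ^ 4" by (simp add: power2_eq_square power4_eq_xxxx)
  then show ?thesis using dist3_nonneg[of u] by linarith
qed

definition flip_sign :: "'a set \<Rightarrow> 'a \<Rightarrow> real" where
  "flip_sign A t = (if t \<in> A then - 1 else 1)"

lemma sum_Pow_insert:
  fixes h :: "'a set \<Rightarrow> 'b :: comm_monoid_add"
  assumes "finite T" "t \<notin> T"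
  shows "sum h (Pow (insert t T)) = (\<Sum>A\<in>Pow T. h A + h (insert t A))"
proof -
  have "inj_on (insert t) (Pow T)" using assms(2) by (meson PowD inj_onI insert_ident subsetD)
  moreover have "Pow T \<inter> insert t ` Pow T = {}" using assms(2) by auto
  ultimately show ?thesis
    using assms by (simp add: Pow_insert sum.union_disjoint sum.reindex sum.distrib)
qed

text \<open>Induction on \<open>T\<close>: pairing \<open>A\<close> with \<open>insert u A\<close>
  cancels the odd powers of \<open>a u\<close>. The fourth moment bound closes with slack
  \<open>4 * 2 ^ card T * a u ^ 4\<close>.\<close>

lemma rademacher_moments:
  fixes a :: "'a \<Rightarrow> real"
  assumes "finite T"
  shows "(\<Sum>A\<in>Pow T. (\<Sum>t\<in>T. a t * flip_sign A t)\<^sup>2) = 2 ^ card T * (\<Sum>t\<in>T. (a t)\<^sup>2)"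
    and "(\<Sum>A\<in>Pow T. (\<Sum>t\<in>T. a t * flip_sign A t) ^ 4) \<le> 3 * 2 ^ card T * (\<Sum>t\<in>T. (a t)\<^sup>2)\<^sup>2"
proof -
  let ?X = "\<lambda>T A. \<Sum>t\<in>T. a t * flip_sign A t"
  let ?W = "\<lambda>T. \<Sum>t\<in>T. (a t)\<^sup>2"
  have "(\<Sum>A\<in>Pow T. (?X T A)\<^sup>2) = 2 ^ card T * ?W T \<and>
        (\<Sum>A\<in>Pow T. ?X T A ^ 4) \<le> 3 * 2 ^ card T * (?W T)\<^sup>2"
    using assms
  proof (induction T rule: finite_induct)
    case empty
    show ?case by simp
  next
    case (insert u T)
    have out: "?X (insert u T) A = ?X T A + a u" if "A \<in> Pow T" for A
      using that insert.hyps by (subst sum.insert) (auto simp: flip_sign_def)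
    have inn: "?X (insert u T) (insert u A) = ?X T A - a u" if "A \<in> Pow T" for A
    proof -
      have "(\<Sum>t\<in>T. a t * flip_sign (insert u A) t) = ?X T A"
        using insert.hyps by (intro sum.cong) (auto simp: flip_sign_def)
      then show ?thesis using insert.hyps by (simp add: flip_sign_def)
    qed
    have "(\<Sum>A\<in>Pow (insert u T). (?X (insert u T) A)\<^sup>2)
        = (\<Sum>A\<in>Pow T. (?X T A + a u)\<^sup>2 + (?X T A - a u)\<^sup>2)"
      unfolding sum_Pow_insert[OF insert.hyps]
      by (intro sum.cong refl) (simp add: out inn)
    also have "\<dots> = (\<Sum>A\<in>Pow T. 2 * (?X T A)\<^sup>2 + 2 * (a u)\<^sup>2)"
      by (intro sum.cong refl) (simp add: power2_eq_square algebra_simps)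
    also have "\<dots> = 2 * (\<Sum>A\<in>Pow T. (?X T A)\<^sup>2) + 2 * 2 ^ card T * (a u)\<^sup>2"
      using insert.hyps by (simp add: sum.distrib sum_distrib_left card_Pow)
    also have "\<dots> = 2 ^ card (insert u T) * ?W (insert u T)"
      using insert by (simp add: algebra_simps)
    finally have second: "(\<Sum>A\<in>Pow (insert u T). (?X (insert u T) A)\<^sup>2)
        = 2 ^ card (insert u T) * ?W (insert u T)" .
    have "(\<Sum>A\<in>Pow (insert u T). ?X (insert u T) A ^ 4)
        = (\<Sum>A\<in>Pow T. (?X T A + a u) ^ 4 + (?X T A - a u) ^ 4)"
      unfolding sum_Pow_insert[OF insert.hyps]
      by (intro sum.cong refl) (simp add: out inn)
    also have "\<dots> = (\<Sum>A\<in>Pow T. 2 * ?X T A ^ 4 + 12 * (a u)\<^sup>2 * (?X T A)\<^sup>2 + 2 * a u ^ 4)"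
      by (intro sum.cong refl) (simp add: power2_eq_square power4_eq_xxxx algebra_simps)
    also have "\<dots> = 2 * (\<Sum>A\<in>Pow T. ?X T A ^ 4) + 12 * (a u)\<^sup>2 * (\<Sum>A\<in>Pow T. (?X T A)\<^sup>2)
        + 2 * 2 ^ card T * a u ^ 4"
      using insert.hyps by (simp add: sum.distrib sum_distrib_left card_Pow)
    also have "\<dots> \<le> 2 * (3 * 2 ^ card T * (?W T)\<^sup>2) + 12 * (a u)\<^sup>2 * (2 ^ card T * ?W T)
        + 2 * 2 ^ card T * a u ^ 4"
      using insert.IH by simp
    also have "\<dots> \<le> 3 * (2 * 2 ^ card T) * ((a u)\<^sup>2 + ?W T)\<^sup>2"
    proof -
      have "3 * (2 * 2 ^ card T) * ((a u)\<^sup>2 + ?W T)\<^sup>2 - (2 * (3 * 2 ^ card T * (?W T)\<^sup>2)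
          + 12 * (a u)\<^sup>2 * (2 ^ card T * ?W T) + 2 * 2 ^ card T * a u ^ 4)
          = 4 * 2 ^ card T * a u ^ 4"
        by (simp add: power2_eq_square power4_eq_xxxx algebra_simps)
      moreover have "0 \<le> 4 * 2 ^ card T * a u ^ 4" by simp
      ultimately show ?thesis by linarith
    qed
    finally have "(\<Sum>A\<in>Pow (insert u T). ?X (insert u T) A ^ 4)
        \<le> 3 * 2 ^ card (insert u T) * (?W (insert u T))\<^sup>2"
      using insert.hyps by simp
    with second show ?case by blast
  qed
  then show "(\<Sum>A\<in>Pow T. (?X T A)\<^sup>2) = 2 ^ card T * ?W T"
    and "(\<Sum>A\<in>Pow T. ?X T A ^ 4) \<le> 3 * 2 ^ card T * (?W T)\<^sup>2" by auto
qed

lemma square_add_le: "(u + v)\<^sup>2 \<le> 2 * u\<^sup>2 + 2 * (v\<^sup>2 :: real)"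
proof -
  have "0 \<le> (u - v)\<^sup>2" by simp
  then show ?thesis by (simp add: power2_eq_square algebra_simps)
qed

lemma square_diff_le: "(u - v)\<^sup>2 \<le> 2 * u\<^sup>2 + 2 * (v\<^sup>2 :: real)"
  using square_add_le[of u "- v"] by simp

text \<open>Flipping the coordinates in \<open>U\<close> shows that \<open>\<Sum>t\<in>U. a t * y t\<close> is close to
  \<open>{-1, 0, 1}\<close>. If its variance is small then, by the fourth moment bound, the nearest point is
  usually \<open>0\<close>, so the variance is even \<open>O(\<delta>)\<close>. Adding the small coefficients one by one
  never crosses the gap between \<open>O(\<delta>)\<close> and a constant.\<close>

lemma cube_near_affine:
  fixes f :: "'a set \<Rightarrow> real" and a :: "'a \<Rightarrow> real" and m \<delta> :: real
  assumes fin: "finite T"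
    and f: "\<And>A. A \<subseteq> T \<Longrightarrow> f A \<in> {0, 1}"
    and err: "(\<Sum>A\<in>Pow T. (f A - (m + (\<Sum>t\<in>T. a t / 2 * flip_sign A t)))\<^sup>2) \<le> \<delta> * 2 ^ card T"
  shows "(\<Sum>t\<in>T. dist3 (a t)) \<le> 584 * \<delta>"
proof -
  define L where "L A = m + (\<Sum>t\<in>T. a t / 2 * flip_sign A t)" for A
  define X where "X U A = (\<Sum>t\<in>U. a t * flip_sign A t)" for U A
  define W where "W U = (\<Sum>t\<in>U. (a t)\<^sup>2)" for U
  define D where "D U A = sym_diff A U" for U A :: "'a set"
  let ?N = "2 ^ card T :: real"
  have Npos: "?N > 0" by simp
  have err': "(\<Sum>A\<in>Pow T. (f A - L A)\<^sup>2) \<le> \<delta> * ?N"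
    using err by (simp add: L_def)
  have "0 \<le> (\<Sum>A\<in>Pow T. (f A - L A)\<^sup>2)" by (simp add: sum_nonneg)
  with err' have "0 \<le> \<delta> * ?N" by linarith
  then have \<delta>0: "0 \<le> \<delta>" using Npos by (simp add: zero_le_mult_iff)
  have DU: "D U A \<in> Pow T" if "U \<subseteq> T" "A \<in> Pow T" for U A
    using that by (auto simp: D_def)
  have DD: "D U (D U A) = A" for U A by (auto simp: D_def)
  have shift: "(\<Sum>A\<in>Pow T. h (D U A)) = (\<Sum>A\<in>Pow T. h A)" if "U \<subseteq> T" for U and h :: "'a set \<Rightarrow> real"
    by (rule sum.reindex_bij_witness[of _ "D U" "D U"]) (use DU[OF that] DD in auto)
  have LD: "L A - L (D U A) = X U A" if "U \<subseteq> T" for U A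
  proof -
    have "L A - L (D U A) = (\<Sum>t\<in>T. a t / 2 * flip_sign A t - a t / 2 * flip_sign (D U A) t)"
      by (simp add: L_def sum_subtractf)
    also have "\<dots> = (\<Sum>t\<in>T. if t \<in> U then a t * flip_sign A t else 0)"
      by (intro sum.cong refl) (auto simp: flip_sign_def D_def)
    also have "\<dots> = X U A"
      using that fin by (simp add: X_def sum.inter_restrict[symmetric] Int_absorb1)
    finally show ?thesis .
  qed
  have res: "(\<Sum>A\<in>Pow T. (X U A - (f A - f (D U A)))\<^sup>2) \<le> 4 * \<delta> * ?N" if U: "U \<subseteq> T" for U
  proof -
    have "(\<Sum>A\<in>Pow T. (X U A - (f A - f (D U A)))\<^sup>2)
        \<le> (\<Sum>A\<in>Pow T. 2 * (f A - L A)\<^sup>2 + 2 * (f (D U A) - L (D U A))\<^sup>2)"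
    proof (intro sum_mono)
      fix A
      have eq: "X U A - (f A - f (D U A)) = (f (D U A) - L (D U A)) - (f A - L A)"
        using LD[OF U, of A] by simp
      then show "(X U A - (f A - f (D U A)))\<^sup>2
          \<le> 2 * (f A - L A)\<^sup>2 + 2 * (f (D U A) - L (D U A))\<^sup>2"
        unfolding eq using square_diff_le[of "f (D U A) - L (D U A)" "f A - L A"] by linarith
    qed
    also have "\<dots> = 4 * (\<Sum>A\<in>Pow T. (f A - L A)\<^sup>2)"
      using shift[OF U, of "\<lambda>A. (f A - L A)\<^sup>2"] by (simp add: sum.distrib sum_distrib_left[symmetric])
    finally show ?thesis using err' by simp
  qed
  \<comment> \<open>The only possible differences of Boolean values; this is why
    \<open>dist3\<close> measures the distance to these three points.\<close>
  have fdiff: "f A - f (D U A) \<in> {- 1, 0, 1}" if "U \<subseteq> T" "A \<in> Pow T" for U A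
    using f[of A] f[of "D U A"] DU[OF that] that by auto
  have dist: "(\<Sum>A\<in>Pow T. dist3 (X U A)) \<le> 4 * \<delta> * ?N" if U: "U \<subseteq> T" for U
  proof -
    have "(\<Sum>A\<in>Pow T. dist3 (X U A)) \<le> (\<Sum>A\<in>Pow T. (X U A - (f A - f (D U A)))\<^sup>2)"
      by (intro sum_mono dist3_le fdiff[OF U])
    then show ?thesis using res[OF U] by linarith
  qed
  have mom: "(\<Sum>A\<in>Pow T. (X U A)\<^sup>2) = ?N * W U"
    "(\<Sum>A\<in>Pow T. X U A ^ 4) \<le> 3 * ?N * (W U)\<^sup>2" if U: "U \<subseteq> T" for U
  proof -
    let ?a = "\<lambda>t. if t \<in> U then a t else 0"
    have "(\<Sum>t\<in>T. ?a t * flip_sign A t) = X U A" for A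
    proof -
      have "(\<Sum>t\<in>T. ?a t * flip_sign A t) = (\<Sum>t\<in>T. if t \<in> U then a t * flip_sign A t else 0)"
        by (intro sum.cong) auto
      then show ?thesis using U fin by (simp add: X_def sum.inter_restrict[symmetric] Int_absorb1)
    qed
    moreover have "(\<Sum>t\<in>T. (?a t)\<^sup>2) = W U"
    proof -
      have "(\<Sum>t\<in>T. (?a t)\<^sup>2) = (\<Sum>t\<in>T. if t \<in> U then (a t)\<^sup>2 else 0)"
        by (intro sum.cong) auto
      then show ?thesis using U fin by (simp add: W_def sum.inter_restrict[symmetric] Int_absorb1)
    qed
    ultimately show "(\<Sum>A\<in>Pow T. (X U A)\<^sup>2) = ?N * W U"
      "(\<Sum>A\<in>Pow T. X U A ^ 4) \<le> 3 * ?N * (W U)\<^sup>2"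
      using rademacher_moments[OF fin, of ?a] by simp_all
  qed
  \<comment> \<open>With 1/24 the correction \<open>12 * W^2\<close> is at most half of
    \<open>W\<close>, so the bound \<open>4 * \<delta>\<close> only doubles.\<close>
  have gap: "W U \<le> 8 * \<delta>" if U: "U \<subseteq> T" and small: "W U \<le> 1 / 24" for U
  proof -
    have "?N * W U - 4 * (3 * ?N * (W U)\<^sup>2) \<le> (\<Sum>A\<in>Pow T. (X U A)\<^sup>2 - 4 * X U A ^ 4)"
      using mom[OF U] by (simp add: sum_subtractf sum_distrib_left[symmetric] mult_ac)
    also have "\<dots> \<le> (\<Sum>A\<in>Pow T. dist3 (X U A))"
      by (intro sum_mono dist3_ge)
    also have "\<dots> \<le> 4 * \<delta> * ?N" by (rule dist[OF U])
    finally have "?N * (W U - 12 * (W U)\<^sup>2) \<le> ?N * (4 * \<delta>)" by (simp add: algebra_simps)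
    then have 1: "W U - 12 * (W U)\<^sup>2 \<le> 4 * \<delta>" using Npos by (simp only: mult_le_cancel_left_pos)
    have "0 \<le> W U" by (simp add: W_def sum_nonneg)
    then have "W U * W U \<le> W U * (1 / 24)" using small by (intro mult_left_mono)
    with 1 show ?thesis by (simp add: power2_eq_square)
  qed
  \<comment> \<open>For one flip \<open>X {t} A\<close> is \<open>a t\<close> up to sign, so
    \<open>dist3\<close> is the same for every \<open>A\<close>.\<close>
  have single: "dist3 (a t) \<le> 4 * \<delta>" if t: "t \<in> T" for t
  proof -
    have "dist3 (X {t} A) = dist3 (a t)" for A
      by (simp add: X_def flip_sign_def)
    then have "?N * dist3 (a t) \<le> ?N * (4 * \<delta>)"
      using dist[of "{t}"] t fin by (simp add: card_Pow mult_ac)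
    then show ?thesis using Npos by (simp only: mult_le_cancel_left_pos)
  qed
  have total: "W T \<le> 2 + 8 * \<delta>"
  proof -
    have "?N * W T = (\<Sum>A\<in>Pow T. (X T A)\<^sup>2)" using mom(1)[of T] by simp
    also have "\<dots> \<le> (\<Sum>A\<in>Pow T. 2 * (X T A - (f A - f (D T A)))\<^sup>2 + 2)"
    proof (intro sum_mono)
      fix A assume A: "A \<in> Pow T"
      have "(f A - f (D T A))\<^sup>2 \<le> 1" using fdiff[of T A] A by auto
      then show "(X T A)\<^sup>2 \<le> 2 * (X T A - (f A - f (D T A)))\<^sup>2 + 2"
        using square_add_le[of "X T A - (f A - f (D T A))" "f A - f (D T A)"] by simp
    qed
    also have "\<dots> = 2 * (\<Sum>A\<in>Pow T. (X T A - (f A - f (D T A)))\<^sup>2) + 2 * ?N"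
      using fin by (simp add: sum.distrib sum_distrib_left card_Pow)
    also have "\<dots> \<le> 2 * (4 * \<delta> * ?N) + 2 * ?N" using res[of T] by simp
    finally have "?N * W T \<le> ?N * (2 + 8 * \<delta>)" by (simp add: algebra_simps)
    then show ?thesis using Npos by (simp only: mult_le_cancel_left_pos)
  qed
  show ?thesis
  \<comment> \<open>Above 1/288 the crude bound \<open>2 + 8 * \<delta>\<close> is below
    \<open>584 * \<delta>\<close>, which is the origin of 584. Below it, a further small coefficient
    lifts \<open>W\<close> from \<open>8 * \<delta>\<close> to at most
    \<open>12 * \<delta> \<le> 1 / 24\<close>, so \<open>gap\<close> applies again.\<close>
  proof (cases "\<delta> \<le> 1 / 288")
    case False
    have "(\<Sum>t\<in>T. dist3 (a t)) \<le> W T" unfolding W_def by (intro sum_mono dist3_le_square)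
    then show ?thesis using total False by linarith
  next
    case True
    define Sm where "Sm = {t \<in> T. \<bar>a t\<bar> \<le> 1 / 2}"
    define Lg where "Lg = {t \<in> T. \<not> \<bar>a t\<bar> \<le> 1 / 2}"
    have finS: "finite Sm" "finite Lg" using fin by (auto simp: Sm_def Lg_def)
    have "W U \<le> 8 * \<delta>" if "finite U" "U \<subseteq> Sm" for U
      using that
    proof (induction U rule: finite_induct)
      case empty
      then show ?case using \<delta>0 by (simp add: W_def)
    next
      case (insert t U)
      have t: "t \<in> T" "(a t)\<^sup>2 \<le> 4 * \<delta>"
        using insert.prems single[of t] dist3_eq_square[of "a t"] by (auto simp: Sm_def)
      have sub: "insert t U \<subseteq> T" using insert.prems by (auto simp: Sm_def)
      have "W (insert t U) = (a t)\<^sup>2 + W U" using insert.hyps by (simp add: W_def)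
      then have "W (insert t U) \<le> 1 / 24" using insert t True by simp
      with gap[OF sub] show ?case by simp
    qed
    then have small: "W Sm \<le> 8 * \<delta>" using finS by simp
    have "(\<Sum>t\<in>Sm. dist3 (a t)) \<le> W Sm" unfolding W_def by (intro sum_mono dist3_le_square)
    with small have 1: "(\<Sum>t\<in>Sm. dist3 (a t)) \<le> 8 * \<delta>" by linarith
    have "(\<Sum>t\<in>Lg. 1 / 4) \<le> W Lg" unfolding W_def
    proof (intro sum_mono)
      fix t assume "t \<in> Lg"
      then have "(1 / 2)\<^sup>2 \<le> \<bar>a t\<bar>\<^sup>2" by (intro power_mono) (auto simp: Lg_def)
      then show "1 / 4 \<le> (a t)\<^sup>2" by (simp add: power2_eq_square)
    qed
    moreover have "W Lg \<le> W T" unfolding W_def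
      by (intro sum_mono2) (auto simp: Lg_def fin)
    ultimately have cLg: "real (card Lg) \<le> 12" using total True by simp
    have "(\<Sum>t\<in>Lg. dist3 (a t)) \<le> (\<Sum>t\<in>Lg. 4 * \<delta>)"
      by (intro sum_mono single) (auto simp: Lg_def)
    also have "\<dots> = real (card Lg) * (4 * \<delta>)" by simp
    also have "\<dots> \<le> 12 * (4 * \<delta>)" using cLg \<delta>0 by (intro mult_right_mono) auto
    finally have 2: "(\<Sum>t\<in>Lg. dist3 (a t)) \<le> 48 * \<delta>" by simp
    have "(\<Sum>t\<in>T. dist3 (a t)) = (\<Sum>t\<in>Sm. dist3 (a t)) + (\<Sum>t\<in>Lg. dist3 (a t))"
    proof -
      have "T = Sm \<union> Lg" "Sm \<inter> Lg = {}" by (auto simp: Sm_def Lg_def)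
      then show ?thesis using finS by (simp add: sum.union_disjoint)
    qed
    with 1 2 \<delta>0 show ?thesis by linarith
  qed
qed

section \<open>Counting and symmetry in the slice\<close>

lemma slice_coord: "x \<in> slice n k \<Longrightarrow> i \<in> {1..n} \<Longrightarrow> x i = 0 \<or> x i = 1"
  by (auto simp: slice_def)

text \<open>A point is determined by the places of its remaining \<open>k - card J\<close> ones.
  Without \<open>card J \<le> k\<close> the truncated subtraction would count one point where there
  is none.\<close>

lemma card_slice_pattern:
  assumes "J \<subseteq> {1..n}" "Z \<subseteq> {1..n}" "J \<inter> Z = {}" "card J \<le> k"
  shows "card {x \<in> slice n k. (\<forall>i\<in>J. x i = 1) \<and> (\<forall>i\<in>Z. x i = 0)}
    = (n - card J - card Z) choose (k - card J)"
proof -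
  let ?I = "{1..n}"
  let ?F = "\<lambda>B. restrict (\<lambda>i. if i \<in> J \<union> B then 1 else 0 :: real) ?I"
  let ?G = "\<lambda>x :: nat \<Rightarrow> real. {i \<in> ?I. x i = 1} - J"
  let ?P = "{B. B \<subseteq> ?I - J - Z \<and> card B = k - card J}"
  let ?Q = "{x \<in> slice n k. (\<forall>i\<in>J. x i = 1) \<and> (\<forall>i\<in>Z. x i = 0)}"
  have fin: "finite J" "finite Z" using assms finite_subset by blast+
  have sum_eq: "(\<Sum>i=1..n. x i) = real (card {i \<in> ?I. x i = 1})"
    if "x \<in> ?I \<rightarrow>\<^sub>E {0, 1}" for x :: "nat \<Rightarrow> real"
  proof -
    have "(\<Sum>i=1..n. x i) = (\<Sum>i=1..n. if x i = 1 then 1 else 0)"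
      using that by (intro sum.cong) (auto simp: PiE_iff)
    then show ?thesis by (simp add: sum.If_cases Int_def)
  qed
  have "bij_betw ?F ?P ?Q"
  proof (rule bij_betw_byWitness[where f' = ?G])
    show "\<forall>B\<in>?P. ?G (?F B) = B" using assms by auto
    show "\<forall>x\<in>?Q. ?F (?G x) = x"
    proof
      fix x assume x: "x \<in> ?Q"
      show "?F (?G x) = x"
      proof
        fix i
        show "?F (?G x) i = x i"
        proof (cases "i \<in> ?I")
          case True
          then show ?thesis using x slice_coord[of x n k i] by auto
        next
          case False
          then show ?thesis using x by (auto simp: slice_def PiE_iff extensional_def)
        qed
      qed
    qed
    show "?F ` ?P \<subseteq> ?Q"
    proof (rule image_subsetI)
      fix B assume B: "B \<in> ?P"
      have "{i \<in> ?I. ?F B i = 1} = J \<union> B" using assms B by auto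
      moreover have "card (J \<union> B) = k"
        using B assms fin finite_subset[of B ?I] by (subst card_Un_disjoint) auto
      ultimately have "(\<Sum>i=1..n. ?F B i) = real k"
        by (subst sum_eq) auto
      then show "?F B \<in> ?Q" using B assms by (auto simp: slice_def)
    qed
    show "?G ` ?Q \<subseteq> ?P"
    proof (rule image_subsetI)
      fix x assume x: "x \<in> ?Q"
      then have "card {i \<in> ?I. x i = 1} = k"
        using sum_eq[of x] by (auto simp: slice_def)
      moreover have "J \<subseteq> {i \<in> ?I. x i = 1}" using x assms by blast
      ultimately have "card (?G x) = k - card J" using fin by (simp add: card_Diff_subset)
      moreover have "?G x \<subseteq> ?I - J - Z" using x by fastforce
      ultimately show "?G x \<in> ?P" by blast
    qed
  qed
  from bij_betw_same_card[OF this] have "card ?Q = card ?P" by (rule sym)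
  also have "\<dots> = card (?I - J - Z) choose (k - card J)"
    by (rule n_subsets) auto
  also have "card (?I - J - Z) = n - card J - card Z"
  proof -
    have "Z \<subseteq> ?I - J" using assms by auto
    then show ?thesis using assms fin by (simp add: card_Diff_subset)
  qed
  finally show ?thesis .
qed

lemma card_slice: "card (slice n k) = n choose k"
  using card_slice_pattern[of "{}" n "{}" k] by simp

lemma slice_sqnorm_eq:
  assumes "k \<le> n"
  shows "slice_sqnorm n k h = (\<Sum>x\<in>slice n k. (h x)\<^sup>2) / real (n choose k)"
  unfolding slice_sqnorm_def
  using slice_nonempty[OF assms] by (simp add: integral_pmf_of_set card_slice)

lemma sum_slice_coord:
  assumes "i \<in> {1..n}" "1 \<le> k"
  shows "(\<Sum>x\<in>slice n k. x i) = real ((n - 1) choose (k - 1))"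
proof -
  have "(\<Sum>x\<in>slice n k. x i) = (\<Sum>x\<in>slice n k. if x i = 1 then 1 else 0)"
    by (intro sum.cong refl) (use slice_coord[OF _ assms(1)] in force)
  also have "\<dots> = real (card {x \<in> slice n k. x i = 1})"
    by (simp add: sum.If_cases Int_def)
  finally show ?thesis using card_slice_pattern[of "{i}" n "{}" k] assms by simp
qed

lemma sum_slice_coord_mult:
  assumes "i \<in> {1..n}" "j \<in> {1..n}" "i \<noteq> j" "2 \<le> k"
  shows "(\<Sum>x\<in>slice n k. x i * x j) = real ((n - 2) choose (k - 2))"
proof -
  have "(\<Sum>x\<in>slice n k. x i * x j) = (\<Sum>x\<in>slice n k. if x i = 1 \<and> x j = 1 then 1 else 0)"
    by (intro sum.cong refl) (use slice_coord[OF _ assms(1)] slice_coord[OF _ assms(2)] in force)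
  also have "\<dots> = real (card {x \<in> slice n k. x i = 1 \<and> x j = 1})"
    by (simp add: sum.If_cases Int_def)
  finally show ?thesis using card_slice_pattern[of "{i, j}" n "{}" k] assms by (simp add: numeral_2_eq_2)
qed

lemma sum_slice_coord_diff:
  assumes "i \<in> {1..n}" "j \<in> {1..n}" "i \<noteq> j" "1 \<le> k"
  shows "(\<Sum>x\<in>slice n k. (x i - x j)\<^sup>2) = 2 * real ((n - 2) choose (k - 1))"
proof -
  have "(\<Sum>x\<in>slice n k. (x i - x j)\<^sup>2) = (\<Sum>x\<in>slice n k.
      (if x i = 1 \<and> x j = 0 then 1 else 0) + (if x j = 1 \<and> x i = 0 then 1 else 0))"
    by (intro sum.cong refl) (use slice_coord[OF _ assms(1)] slice_coord[OF _ assms(2)] in force)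
  also have "\<dots> = real (card {x \<in> slice n k. x i = 1 \<and> x j = 0})
      + real (card {x \<in> slice n k. x j = 1 \<and> x i = 0})"
    by (simp add: sum.If_cases Int_def sum.distrib)
  finally show ?thesis
    using card_slice_pattern[of "{i}" n "{j}" k] card_slice_pattern[of "{j}" n "{i}" k] assms
    by (simp add: numeral_2_eq_2)
qed

section \<open>Ratios of neighbouring binomial coefficients\<close>

lemma binomial_drop_chosen:
  assumes "1 \<le> k"
  shows "real k * real (n choose k) = real n * real ((n - 1) choose (k - 1))"
  using times_binomial_minus1_eq[of k n] assms by (metis of_nat_mult less_eq_Suc_le One_nat_def)

lemma binomial_drop_unchosen:
  assumes "k \<le> n"
  shows "(real n - real k) * real (n choose k) = real n * real ((n - 1) choose k)"
  using binomial_absorb_comp[of n k] assms by (metis of_nat_mult of_nat_diff)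

lemma binomial_drop_pair:
  assumes "1 \<le> k" "k \<le> n"
  shows "real n * (real n - 1) * real ((n - 2) choose (k - 1))
    = real k * (real n - real k) * real (n choose k)"
proof -
  have "real k * (real n - real k) * real (n choose k)
      = real n * ((real (n - 1) - real (k - 1)) * real ((n - 1) choose (k - 1)))"
    using binomial_drop_chosen[OF assms(1), of n] assms by (simp add: of_nat_diff mult_ac)
  also have "\<dots> = real n * (real (n - 1) * real ((n - 1 - 1) choose (k - 1)))"
    using assms by (subst binomial_drop_unchosen) auto
  finally show ?thesis using assms by (simp add: of_nat_diff mult_ac numeral_2_eq_2)
qed

section \<open>Coordinate involutions and the cubes they generate\<close>

lemma slice_comp_involution:
  assumes inv: "\<And>i. \<pi> (\<pi> i) = i" and out: "\<And>i. i \<notin> {1..n} \<Longrightarrow> \<pi> i = i"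
    and x: "x \<in> slice n k"
  shows "x \<circ> \<pi> \<in> slice n k"
proof -
  have inI: "\<pi> i \<in> {1..n} \<longleftrightarrow> i \<in> {1..n}" for i
    using inv out by metis
  have "(\<Sum>i=1..n. x (\<pi> i)) = (\<Sum>i=1..n. x i)"
    by (rule sum.reindex_bij_witness[of _ \<pi> \<pi>]) (use inv inI in auto)
  then show ?thesis using x inI out
    by (auto simp: slice_def PiE_iff extensional_def)
qed

lemma sum_slice_involution:
  fixes h :: "(nat \<Rightarrow> real) \<Rightarrow> 'b :: comm_monoid_add"
  assumes inv: "\<And>i. \<pi> (\<pi> i) = i" and out: "\<And>i. i \<notin> {1..n} \<Longrightarrow> \<pi> i = i"
  shows "(\<Sum>x\<in>slice n k. h (x \<circ> \<pi>)) = (\<Sum>x\<in>slice n k. h x)"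
proof -
  have "(x \<circ> \<pi>) \<circ> \<pi> = x" for x :: "nat \<Rightarrow> real" using inv by auto
  then show ?thesis
    by (intro sum.reindex_bij_witness[of _ "\<lambda>x. x \<circ> \<pi>" "\<lambda>x. x \<circ> \<pi>"])
      (use slice_comp_involution[OF inv out] in auto)
qed

lemma sum_involution_orbits:
  fixes g :: "nat \<Rightarrow> real"
  assumes inv: "\<And>i. i \<in> I \<Longrightarrow> \<sigma> i \<in> I \<and> \<sigma> (\<sigma> i) = i" and fin: "finite I"
    and fixp: "\<And>i. i \<in> I \<Longrightarrow> \<sigma> i = i \<Longrightarrow> g i = 0"
  shows "(\<Sum>i\<in>I. g i) = (\<Sum>t\<in>{i \<in> I. i < \<sigma> i}. g t + g (\<sigma> t))"
proof -
  let ?T = "{i \<in> I. i < \<sigma> i}" and ?S = "{i \<in> I. \<sigma> i < i}" and ?F = "{i \<in> I. \<sigma> i = i}"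
  have "sum g I = sum g ((?T \<union> ?S) \<union> ?F)" by (intro sum.cong) auto
  also have "\<dots> = sum g ?T + sum g ?S + sum g ?F"
    using fin by (subst sum.union_disjoint; (subst sum.union_disjoint)?) auto
  also have "sum g ?F = 0" using fixp by simp
  also have "sum g ?S = (\<Sum>t\<in>?T. g (\<sigma> t))"
    by (rule sum.reindex_bij_witness[of _ \<sigma> \<sigma>]) (use inv in auto)
  finally show ?thesis by (simp add: sum.distrib)
qed

text \<open>Composing a point \<open>x\<close> of the slice with all products of transpositions \<open>(t \<sigma>(t))\<close> gives a
  cube inside the slice, on which \<open>f\<close> is close to an affine function.\<close>

lemma dist3_involution:
  fixes f :: "(nat \<Rightarrow> real) \<Rightarrow> real" and c :: "nat \<Rightarrow> real"
  assumes k: "1 \<le> k"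
    and f: "f \<in> slice n k \<rightarrow> {0, 1}"
    and inv: "\<And>i. i \<in> {1..n} \<Longrightarrow> \<sigma> i \<in> {1..n} \<and> \<sigma> (\<sigma> i) = i"
  shows "real ((n - 2) choose (k - 1)) * (\<Sum>i=1..n. dist3 (c i - c (\<sigma> i)))
    \<le> 584 * (\<Sum>x\<in>slice n k. (f x - (\<Sum>i=1..n. c i * x i))\<^sup>2)"
proof -
  define T where "T = {i \<in> {1..n}. i < \<sigma> i}"
  \<comment> \<open>The set \<open>A\<close> selects which transpositions are carried out. The guard
    \<open>i \<in> {1..n}\<close> is needed because \<open>\<sigma>\<close> is arbitrary outside the
    range and could map into \<open>A\<close> there.\<close>
  define \<pi> where "\<pi> A i = (if i \<in> A \<or> i \<in> {1..n} \<and> \<sigma> i \<in> A then \<sigma> i else i)" for A i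
  define d where "d t = c t - c (\<sigma> t)" for t
  define lin where "lin x = (\<Sum>i=1..n. c i * x i)" for x
  \<comment> \<open>The centre of the cube: a sign +1 means no swap, so half of each swap's effect
    is taken off the value at \<open>x\<close>.\<close>
  define m where "m x = lin x - (\<Sum>t\<in>T. d t * (x t - x (\<sigma> t)) / 2)" for x
  define E where "E x = (f x - lin x)\<^sup>2" for x
  let ?N = "2 ^ card T :: real"
  have fin: "finite T" by (simp add: T_def)
  have \<pi>\<pi>: "\<pi> A (\<pi> A i) = i" and \<pi>out: "i \<notin> {1..n} \<Longrightarrow> \<pi> A i = i" if "A \<subseteq> T" for A i
    using that inv by (auto simp: \<pi>_def T_def)
  have affine: "lin (x \<circ> \<pi> A) = m x + (\<Sum>t\<in>T. d t * (x t - x (\<sigma> t)) / 2 * flip_sign A t)"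
    if A: "A \<subseteq> T" for x A
  proof -
    have "lin (x \<circ> \<pi> A) - lin x = (\<Sum>i=1..n. c i * (x (\<pi> A i) - x i))"
      by (simp add: lin_def sum_subtractf algebra_simps)
    also have "\<dots> = (\<Sum>t\<in>T. c t * (x (\<pi> A t) - x t) + c (\<sigma> t) * (x (\<pi> A (\<sigma> t)) - x (\<sigma> t)))"
      unfolding T_def by (rule sum_involution_orbits) (use inv in \<open>auto simp: \<pi>_def\<close>)
    also have "\<dots> = (\<Sum>t\<in>T. d t * (x t - x (\<sigma> t)) / 2 * flip_sign A t - d t * (x t - x (\<sigma> t)) / 2)"
    proof (intro sum.cong refl)
      fix t assume t: "t \<in> T"
      then have t': "t \<in> {1..n}" "t < \<sigma> t" "\<sigma> t \<in> {1..n}" "\<sigma> (\<sigma> t) = t"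
        using inv[of t] by (auto simp: T_def)
      then have "\<sigma> t \<notin> A" using A by (auto simp: T_def)
      then show "c t * (x (\<pi> A t) - x t) + c (\<sigma> t) * (x (\<pi> A (\<sigma> t)) - x (\<sigma> t))
          = d t * (x t - x (\<sigma> t)) / 2 * flip_sign A t - d t * (x t - x (\<sigma> t)) / 2"
        using t' by (cases "t \<in> A") (simp_all add: \<pi>_def d_def flip_sign_def field_simps)
    qed
    finally show ?thesis by (simp add: m_def sum_subtractf)
  qed
  have comp_mem: "x \<circ> \<pi> A \<in> slice n k" if x: "x \<in> slice n k" and A: "A \<subseteq> T" for x A
    using \<pi>\<pi>[OF A] \<pi>out[OF A] x by (rule slice_comp_involution)
  have point: "?N * (\<Sum>t\<in>T. (x t - x (\<sigma> t))\<^sup>2 * dist3 (d t)) \<le> 584 * (\<Sum>A\<in>Pow T. E (x \<circ> \<pi> A))"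
    if x: "x \<in> slice n k" for x
  proof -
    let ?a = "\<lambda>t. d t * (x t - x (\<sigma> t))"
    have "(\<Sum>t\<in>T. dist3 (?a t)) \<le> 584 * ((\<Sum>A\<in>Pow T. E (x \<circ> \<pi> A)) / ?N)"
    proof (rule cube_near_affine[OF fin, where f = "\<lambda>A. f (x \<circ> \<pi> A)" and m = "m x"])
      show "f (x \<circ> \<pi> A) \<in> {0, 1}" if "A \<subseteq> T" for A
        using f comp_mem[OF x that] by (auto simp: Pi_iff)
      have "(\<Sum>A\<in>Pow T. (f (x \<circ> \<pi> A) - (m x + (\<Sum>t\<in>T. ?a t / 2 * flip_sign A t)))\<^sup>2)
          = (\<Sum>A\<in>Pow T. E (x \<circ> \<pi> A))"
        by (intro sum.cong refl) (simp add: E_def affine)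
      then show "(\<Sum>A\<in>Pow T. (f (x \<circ> \<pi> A) - (m x + (\<Sum>t\<in>T. ?a t / 2 * flip_sign A t)))\<^sup>2)
          \<le> (\<Sum>A\<in>Pow T. E (x \<circ> \<pi> A)) / ?N * 2 ^ card T"
        by simp
    qed
    moreover have "dist3 (?a t) = (x t - x (\<sigma> t))\<^sup>2 * dist3 (d t)" if "t \<in> T" for t
    proof -
      have "t \<in> {1..n}" "\<sigma> t \<in> {1..n}" using that inv[of t] by (auto simp: T_def)
      then have "x t - x (\<sigma> t) \<in> {- 1, 0, 1}"
        using slice_coord[OF x, of t] slice_coord[OF x, of "\<sigma> t"] by auto
      moreover have "dist3 0 = 0" by (simp add: dist3_def)
      ultimately show ?thesis by auto
    qed
    ultimately show ?thesis by (simp add: field_simps)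
  qed
  \<comment> \<open>Averaging over \<open>x\<close>: the factor
    \<open>(x t - x (\<sigma> t))^2\<close> keeps just the directions that really move
    \<open>x\<close>. For fixed \<open>A\<close> the map to \<open>x \<circ> \<pi> A\<close>
    permutes the slice, so each \<open>A\<close> contributes the full error once.\<close>
  have "?N * (2 * real ((n - 2) choose (k - 1)) * (\<Sum>t\<in>T. dist3 (d t)))
      = ?N * (\<Sum>t\<in>T. (\<Sum>x\<in>slice n k. (x t - x (\<sigma> t))\<^sup>2) * dist3 (d t))"
  proof -
    have "(\<Sum>x\<in>slice n k. (x t - x (\<sigma> t))\<^sup>2) = 2 * real ((n - 2) choose (k - 1))" if "t \<in> T" for t
      using that inv[of t] k by (intro sum_slice_coord_diff) (auto simp: T_def)
    then show ?thesis by (simp add: sum_distrib_left)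
  qed
  also have "\<dots> = (\<Sum>x\<in>slice n k. ?N * (\<Sum>t\<in>T. (x t - x (\<sigma> t))\<^sup>2 * dist3 (d t)))"
    by (simp add: sum_distrib_left sum_distrib_right) (rule sum.swap)
  also have "\<dots> \<le> (\<Sum>x\<in>slice n k. 584 * (\<Sum>A\<in>Pow T. E (x \<circ> \<pi> A)))"
    by (intro sum_mono point)
  also have "\<dots> = 584 * (\<Sum>A\<in>Pow T. \<Sum>x\<in>slice n k. E (x \<circ> \<pi> A))"
    unfolding sum_distrib_left[symmetric] by (subst sum.swap) simp
  also have "(\<Sum>A\<in>Pow T. \<Sum>x\<in>slice n k. E (x \<circ> \<pi> A)) = (\<Sum>A\<in>Pow T. \<Sum>x\<in>slice n k. E x)"
    by (intro sum.cong refl sum_slice_involution) (use \<pi>\<pi> \<pi>out in auto)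
  also have "\<dots> = ?N * (\<Sum>x\<in>slice n k. E x)"
    using fin by (simp add: card_Pow)
  finally have "?N * (2 * real ((n - 2) choose (k - 1)) * (\<Sum>t\<in>T. dist3 (d t)))
      \<le> ?N * (584 * (\<Sum>x\<in>slice n k. E x))" by (simp only: mult_ac)
  then have "2 * real ((n - 2) choose (k - 1)) * (\<Sum>t\<in>T. dist3 (d t)) \<le> 584 * (\<Sum>x\<in>slice n k. E x)"
    by (simp only: mult_le_cancel_left_pos zero_less_power zero_less_numeral)
  \<comment> \<open>Each transposition is met at both of its ends, which absorbs the factor 2 from
    \<open>sum_slice_coord_diff\<close>.\<close>
  moreover have "(\<Sum>i=1..n. dist3 (c i - c (\<sigma> i))) = (\<Sum>t\<in>T. dist3 (d t) + dist3 (d (\<sigma> t)))"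
    unfolding T_def d_def
    by (rule sum_involution_orbits) (use inv in \<open>auto simp: dist3_def\<close>)
  moreover have "dist3 (d (\<sigma> t)) = dist3 (d t)" if "t \<in> T" for t
  proof -
    have "d (\<sigma> t) = - d t" using that inv[of t] by (auto simp: T_def d_def)
    then show ?thesis by simp
  qed
  ultimately show ?thesis
    by (simp add: E_def lin_def sum_distrib_left[symmetric] mult.assoc mult.left_commute)
qed

section \<open>Rounding the coefficients\<close>

text \<open>The involutions \<open>i \<mapsto> 1 + (r - i) mod n\<close> form a round-robin tournament: every ordered pair
  occurs for exactly one \<open>r\<close>.\<close>

lemma dist3_center:
  fixes f :: "(nat \<Rightarrow> real) \<Rightarrow> real" and c :: "nat \<Rightarrow> real"
  assumes k: "1 \<le> k" "k \<le> n" and f: "f \<in> slice n k \<rightarrow> {0, 1}"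
  obtains z where "real ((n - 2) choose (k - 1)) * (\<Sum>i=1..n. dist3 (c i - z))
    \<le> 584 * (\<Sum>x\<in>slice n k. (f x - (\<Sum>i=1..n. c i * x i))\<^sup>2)"
proof -
  let ?b = "real ((n - 2) choose (k - 1))"
  let ?E = "\<Sum>x\<in>slice n k. (f x - (\<Sum>i=1..n. c i * x i))\<^sup>2"
  \<comment> \<open>The summand \<open>n\<close> keeps the natural subtraction from truncating; the
    leading 1 adjusts residues to indices that start at 1.\<close>
  define \<sigma> where "\<sigma> r i = 1 + (r + n - i) mod n" for r i
  have n: "1 \<le> n" using k by simp
  have range: "\<sigma> r i \<in> {1..n}" for r i
    using n by (simp add: \<sigma>_def Suc_le_eq)
  have rev: "(r + n - i) mod n = j - 1 \<longleftrightarrow> r = (i + j - 1) mod n"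
    if "r < n" "i \<in> {1..n}" "j \<in> {1..n}" for r i j
  proof -
    have "r + n - i = (if i \<le> r then r - i + n else r + n - i)" using that by auto
    then have "(r + n - i) mod n = (if i \<le> r then r - i else r + n - i)"
      using that by (auto simp del: Nat.add_diff_assoc2)
    moreover have "(i + j - 1) mod n = (if i + j - 1 < n then i + j - 1 else i + j - 1 - n)"
      using that by (auto simp: mod_if)
    ultimately show ?thesis using that by (auto split: if_splits)
  qed
  have rev': "\<sigma> r i = j \<longleftrightarrow> r = (i + j - 1) mod n" if "r < n" "i \<in> {1..n}" "j \<in> {1..n}" for r i j
    using rev[OF that] that by (auto simp: \<sigma>_def)
  have inv: "\<sigma> r (\<sigma> r i) = i" if "r < n" "i \<in> {1..n}" for r i
    using rev'[of r i "\<sigma> r i"] rev'[of r "\<sigma> r i" i] range that by (simp add: add.commute)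
  have "(\<Sum>j=1..n. ?b * (\<Sum>i=1..n. dist3 (c i - c j))) = ?b * (\<Sum>i=1..n. \<Sum>j=1..n. dist3 (c i - c j))"
    by (subst sum.swap) (simp add: sum_distrib_left)
  also have "(\<Sum>i=1..n. \<Sum>j=1..n. dist3 (c i - c j)) = (\<Sum>i=1..n. \<Sum>r<n. dist3 (c i - c (\<sigma> r i)))"
  proof (rule sum.cong[OF refl])
    fix i assume i: "i \<in> {1..n}"
    show "(\<Sum>j=1..n. dist3 (c i - c j)) = (\<Sum>r<n. dist3 (c i - c (\<sigma> r i)))"
    proof (rule sum.reindex_bij_witness[of _ "\<lambda>r. \<sigma> r i" "\<lambda>j. (i + j - 1) mod n"])
      fix j assume j: "j \<in> {1..n}"
      have lt: "(i + j - 1) mod n < n" using n by simp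
      then show "(i + j - 1) mod n \<in> {..<n}" by simp
      show "\<sigma> ((i + j - 1) mod n) i = j" using rev'[OF lt i j] by simp
      then show "dist3 (c i - c (\<sigma> ((i + j - 1) mod n) i)) = dist3 (c i - c j)" by simp
    next
      fix r assume r: "r \<in> {..<n}"
      show "\<sigma> r i \<in> {1..n}" by (rule range)
      show "(i + \<sigma> r i - 1) mod n = r" using rev'[of r i "\<sigma> r i"] i range[of r i] r by simp
    qed
  qed
  also have "?b * \<dots> = (\<Sum>r<n. ?b * (\<Sum>i=1..n. dist3 (c i - c (\<sigma> r i))))"
    by (subst sum.swap) (simp add: sum_distrib_left)
  also have "\<dots> \<le> (\<Sum>r<n. 584 * ?E)"
    using inv range by (intro sum_mono dist3_involution[OF k(1) f]) auto
  also have "\<dots> = (\<Sum>j=1..n. 584 * ?E)" by simp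
  \<comment> \<open>The bound holds on average over \<open>j\<close>, hence for some
    \<open>j\<close>, and \<open>c j\<close> serves as the centre.\<close>
  finally have "\<exists>j\<in>{1..n}. ?b * (\<Sum>i=1..n. dist3 (c i - c j)) \<le> 584 * ?E"
    using sum_strict_mono[of "{1..n}" "\<lambda>j. 584 * ?E" "\<lambda>j. ?b * (\<Sum>i=1..n. dist3 (c i - c j))"] n
    by (force simp: not_le)
  then show ?thesis using that by blast
qed

section \<open>Mean and variance of linear functions on the slice\<close>

lemma sum_slice_linear:
  assumes "1 \<le> k"
  shows "(\<Sum>x\<in>slice n k. \<Sum>i=1..n. h i * x i) = real ((n - 1) choose (k - 1)) * (\<Sum>i=1..n. h i)"
proof -
  have "(\<Sum>x\<in>slice n k. \<Sum>i=1..n. h i * x i) = (\<Sum>i=1..n. h i * (\<Sum>x\<in>slice n k. x i))"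
    by (subst sum.swap) (simp add: sum_distrib_left)
  also have "\<dots> = (\<Sum>i=1..n. h i * real ((n - 1) choose (k - 1)))"
    by (intro sum.cong refl) (simp only: sum_slice_coord[OF _ assms])
  finally show ?thesis by (simp only: sum_distrib_right[symmetric] mult.commute)
qed

lemma sum_slice_linear_square:
  assumes "2 \<le> k"
  shows "(\<Sum>x\<in>slice n k. (\<Sum>i=1..n. h i * x i)\<^sup>2)
    = real ((n - 1) choose (k - 1)) * (\<Sum>i=1..n. (h i)\<^sup>2)
      + real ((n - 2) choose (k - 2)) * ((\<Sum>i=1..n. h i)\<^sup>2 - (\<Sum>i=1..n. (h i)\<^sup>2))"
proof -
  let ?a = "real ((n - 1) choose (k - 1))" and ?b = "real ((n - 2) choose (k - 2))"
  have pair: "(\<Sum>x\<in>slice n k. x i * x j) = ?b + (if i = j then ?a - ?b else 0)"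
    if ij: "i \<in> {1..n}" "j \<in> {1..n}" for i j
  proof (cases "i = j")
    case True
    have "(\<Sum>x\<in>slice n k. x i * x i) = (\<Sum>x\<in>slice n k. x i)"
      by (intro sum.cong refl) (use slice_coord[OF _ ij(1)] in force)
    then show ?thesis using True sum_slice_coord[OF ij(1)] assms by simp
  next
    case False
    then show ?thesis using sum_slice_coord_mult[OF ij False assms] by simp
  qed
  have "(\<Sum>x\<in>slice n k. (\<Sum>i=1..n. h i * x i)\<^sup>2)
      = (\<Sum>x\<in>slice n k. \<Sum>i=1..n. \<Sum>j=1..n. h i * h j * (x i * x j))"
    by (intro sum.cong refl) (simp add: power2_eq_square sum_product mult_ac)
  also have "\<dots> = (\<Sum>i=1..n. \<Sum>x\<in>slice n k. \<Sum>j=1..n. h i * h j * (x i * x j))"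
    by (rule sum.swap)
  also have "\<dots> = (\<Sum>i=1..n. \<Sum>j=1..n. \<Sum>x\<in>slice n k. h i * h j * (x i * x j))"
    by (intro sum.cong refl sum.swap)
  also have "\<dots> = (\<Sum>i=1..n. \<Sum>j=1..n. h i * h j * (?b + (if i = j then ?a - ?b else 0)))"
    by (intro sum.cong refl) (simp add: sum_distrib_left[symmetric] pair)
  also have "\<dots> = (\<Sum>i=1..n. \<Sum>j=1..n. ?b * (h i * h j))
      + (\<Sum>i=1..n. \<Sum>j=1..n. if i = j then (?a - ?b) * (h i * h j) else 0)"
    unfolding sum.distrib[symmetric]
    by (intro sum.cong refl) (auto simp: algebra_simps)
  also have "(\<Sum>i=1..n. \<Sum>j=1..n. if i = j then (?a - ?b) * (h i * h j) else 0)
      = (?a - ?b) * (\<Sum>i=1..n. (h i)\<^sup>2)"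
    by (simp add: sum.delta sum_distrib_left power2_eq_square)
  also have "(\<Sum>i=1..n. \<Sum>j=1..n. ?b * (h i * h j)) = ?b * (\<Sum>i=1..n. h i)\<^sup>2"
    by (simp only: power2_eq_square sum_distrib_left[symmetric] sum_distrib_right[symmetric])
  finally show ?thesis by (simp add: algebra_simps)
qed

text \<open>The subtracted mean is that over the slice. The last factor is the sum of squared
  deviations of the coefficients from their average; it vanishes for constant \<open>h\<close>, as
  it must, since the function is then constant on the slice.\<close>

lemma slice_variance:
  assumes k: "2 \<le> k" "k \<le> n"
  shows "(\<Sum>x\<in>slice n k. ((\<Sum>i=1..n. h i * x i) - real k / real n * (\<Sum>i=1..n. h i))\<^sup>2)
    = real (n choose k) * (real k * (real n - real k) / (real n * (real n - 1)))
      * ((\<Sum>i=1..n. (h i)\<^sup>2) - (\<Sum>i=1..n. h i)\<^sup>2 / real n)"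
proof -
  let ?M = "real (n choose k)" and ?s = "\<Sum>i=1..n. h i" and ?q = "\<Sum>i=1..n. (h i)\<^sup>2"
  let ?H = "\<lambda>x. \<Sum>i=1..n. h i * x i"
  define \<mu> where "\<mu> = real k / real n * ?s"
  have n: "real n > 1" using k by simp
  have a: "real ((n - 1) choose (k - 1)) = real k / real n * ?M"
    using binomial_drop_chosen[of k n] k n by (simp add: field_simps)
  have "real (k - 1) * real ((n - 1) choose (k - 1)) = real (n - 1) * real ((n - 1 - 1) choose (k - 1 - 1))"
    using k by (intro binomial_drop_chosen) auto
  then have b: "real ((n - 2) choose (k - 2)) = real k * (real k - 1) / (real n * (real n - 1)) * ?M"
    using k n unfolding a by (simp add: numeral_2_eq_2 of_nat_diff field_simps)
  have "(\<Sum>x\<in>slice n k. (?H x - \<mu>)\<^sup>2)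
      = (\<Sum>x\<in>slice n k. (?H x)\<^sup>2) - 2 * \<mu> * (\<Sum>x\<in>slice n k. ?H x) + ?M * \<mu>\<^sup>2"
    by (simp add: power2_diff sum.distrib sum_subtractf sum_distrib_left[symmetric]
        sum_distrib_right[symmetric] card_slice mult_ac)
  also have "\<dots> = real k / real n * ?M * ?q
      + real k * (real k - 1) / (real n * (real n - 1)) * ?M * (?s\<^sup>2 - ?q)
      - 2 * \<mu> * (real k / real n * ?M * ?s) + ?M * \<mu>\<^sup>2"
    using k by (subst sum_slice_linear_square; (subst sum_slice_linear)?) (simp_all only: a b)
  also have "\<dots> = ?M * (real k * (real n - real k) / (real n * (real n - 1))) * (?q - ?s\<^sup>2 / real n)"
    using n by (simp add: \<mu>_def divide_simps) (simp add: power2_eq_square algebra_simps)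
  finally show ?thesis by (simp only: \<mu>_def)
qed

text \<open>The mean minimises the mean square deviation: the cross term sums to 0.\<close>

lemma slice_variance_le:
  assumes k: "1 \<le> k" "k \<le> n"
  shows "(\<Sum>x\<in>slice n k. ((\<Sum>i=1..n. h i * x i) - real k / real n * (\<Sum>i=1..n. h i))\<^sup>2)
    \<le> (\<Sum>x\<in>slice n k. ((\<Sum>i=1..n. h i * x i) - z)\<^sup>2)"
proof -
  let ?M = "real (n choose k)" and ?H = "\<lambda>x. \<Sum>i=1..n. h i * x i"
  define \<mu> where "\<mu> = real k / real n * (\<Sum>i=1..n. h i)"
  have "real ((n - 1) choose (k - 1)) = real k / real n * ?M"
    using binomial_drop_chosen[of k n] k by (simp add: field_simps)
  then have mean: "(\<Sum>x\<in>slice n k. ?H x) = \<mu> * ?M"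
    unfolding sum_slice_linear[OF k(1)] \<mu>_def by simp
  have "(\<Sum>x\<in>slice n k. (?H x - z)\<^sup>2)
      = (\<Sum>x\<in>slice n k. (?H x - \<mu>)\<^sup>2 + 2 * (\<mu> - z) * (?H x - \<mu>) + (\<mu> - z)\<^sup>2)"
    by (intro sum.cong refl) (simp add: power2_eq_square algebra_simps)
  also have "\<dots> = (\<Sum>x\<in>slice n k. (?H x - \<mu>)\<^sup>2) + 2 * (\<mu> - z) * ((\<Sum>x\<in>slice n k. ?H x) - \<mu> * ?M)
      + ?M * (\<mu> - z)\<^sup>2"
    by (simp add: sum.distrib sum_distrib_left[symmetric] sum_subtractf card_slice mult_ac)
  finally show ?thesis unfolding mean \<mu>_def[symmetric] by simp
qed

text \<open>The constant stays separate: absorbing it into the coefficients would add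
  \<open>N / k\<close> to each, which need not be an integer.\<close>

definition int_affine :: "nat \<Rightarrow> int \<Rightarrow> (nat \<Rightarrow> int) \<Rightarrow> (nat \<Rightarrow> real) \<Rightarrow> real" where
  "int_affine n N r x = of_int N + (\<Sum>i=1..n. of_int (r i) * x i)"

lemma int_affine_Ints:
  assumes "x \<in> slice n k"
  shows "int_affine n N r x \<in> \<int>"
proof -
  have "x i \<in> \<int>" if "i \<in> {1..n}" for i using slice_coord[OF assms that] by auto
  then show ?thesis unfolding int_affine_def by (intro Ints_add Ints_sum Ints_mult) auto
qed

text \<open>On the slice the part \<open>z * x i\<close> sums to the constant \<open>k * z\<close>,
  so only the deviations \<open>h i\<close> of \<open>c i - z\<close> from their roundings matter.
  Their linear form is close to its mean \<open>\<mu>\<close>, and the constant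
  \<open>k * z + \<mu>\<close> that remains is rounded last.\<close>

lemma int_affine_approx:
  fixes f :: "(nat \<Rightarrow> real) \<Rightarrow> real" and c :: "nat \<Rightarrow> real"
  assumes k: "2 \<le> k" "2 * k \<le> n" and f: "f \<in> slice n k \<rightarrow> {0, 1}"
    and err: "(\<Sum>x\<in>slice n k. (f x - (\<Sum>i=1..n. c i * x i))\<^sup>2) \<le> \<epsilon> * real (n choose k)"
  obtains N r where "\<And>i. r i \<in> {- 1, 0, 1}"
    "(\<Sum>x\<in>slice n k. (f x - int_affine n N r x)\<^sup>2) \<le> 9352 * \<epsilon> * real (n choose k)"
proof -
  let ?M = "real (n choose k)"
  have n: "real n \<ge> 4" "real k \<ge> 2" "2 * real k \<le> real n" using k by linarith+
  have M: "?M > 0" using k by simp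
  have kn: "1 \<le> k" "k \<le> n" using k by auto
  obtain z where z: "real ((n - 2) choose (k - 1)) * (\<Sum>i=1..n. dist3 (c i - z))
    \<le> 584 * (\<Sum>x\<in>slice n k. (f x - (\<Sum>i=1..n. c i * x i))\<^sup>2)"
    using dist3_center[OF kn f] by blast
  have "\<forall>i. \<exists>v. v \<in> {- 1, 0, 1::int} \<and> (c i - z - of_int v)\<^sup>2 = dist3 (c i - z)"
  proof
    fix i
    obtain v where v: "v \<in> {- 1, 0, 1::real}" "(c i - z - v)\<^sup>2 = dist3 (c i - z)"
      by (rule dist3_attained)
    from v(1) obtain w :: int where w: "w \<in> {- 1, 0, 1}" "v = of_int w"
      by (auto intro: that[of "- 1"] that[of 0] that[of 1])
    show "\<exists>v. v \<in> {- 1, 0, 1::int} \<and> (c i - z - of_int v)\<^sup>2 = dist3 (c i - z)"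
      by (rule exI[of _ w], rule conjI[OF w(1)], rule v(2)[unfolded w(2)])
  qed
  from choice[OF this] obtain r :: "nat \<Rightarrow> int"
    where r': "\<forall>i. r i \<in> {- 1, 0, 1} \<and> (c i - z - of_int (r i))\<^sup>2 = dist3 (c i - z)"
    by (rule exE)
  have r: "\<And>i. r i \<in> {- 1, 0, 1}" "\<And>i. (c i - z - of_int (r i))\<^sup>2 = dist3 (c i - z)"
    using r' by blast+
  define h where "h i = c i - z - of_int (r i)" for i
  define \<mu> where "\<mu> = real k / real n * (\<Sum>i=1..n. h i)"
  define H where "H x = (\<Sum>i=1..n. h i * x i)" for x
  define c0 where "c0 = real k * z + \<mu>"
  define F where "F x = (\<Sum>i=1..n. of_int (r i) * x i)" for x :: "nat \<Rightarrow> real"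
  let ?q = "real k * (real n - real k) / (real n * (real n - 1))"
  \<comment> \<open>The variance factor is exactly the weight in \<open>dist3_center\<close>; hence
    no power of \<open>1/p\<close> is lost.\<close>
  have q: "?q * ?M = real ((n - 2) choose (k - 1))"
    using binomial_drop_pair[OF kn] n by (simp add: field_simps)
  have q0: "0 \<le> ?q" using n by simp
  have "(\<Sum>x\<in>slice n k. (H x - \<mu>)\<^sup>2) = ?M * ?q * ((\<Sum>i=1..n. (h i)\<^sup>2) - (\<Sum>i=1..n. h i)\<^sup>2 / real n)"
    unfolding H_def \<mu>_def by (rule slice_variance[OF k(1) kn(2)])
  also have "\<dots> \<le> ?M * ?q * (\<Sum>i=1..n. (h i)\<^sup>2)"
    using M q0 by (intro mult_left_mono mult_nonneg_nonneg) auto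
  also have "\<dots> \<le> 584 * (\<epsilon> * ?M)"
    using z err unfolding h_def r(2) q[symmetric] by (simp add: mult_ac)
  finally have var: "(\<Sum>x\<in>slice n k. (H x - \<mu>)\<^sup>2) \<le> 584 * (\<epsilon> * ?M)" .
  have split: "(\<Sum>i=1..n. c i * x i) = real k * z + F x + H x" if "x \<in> slice n k" for x
  proof -
    have "real k * z + F x + H x = (\<Sum>i=1..n. z * x i + of_int (r i) * x i + h i * x i)"
      using that by (simp add: F_def H_def sum.distrib sum_distrib_left[symmetric] slice_def)
    also have "\<dots> = (\<Sum>i=1..n. c i * x i)"
      by (intro sum.cong refl) (simp add: h_def algebra_simps)
    finally show ?thesis by simp
  qed
  have "(\<Sum>x\<in>slice n k. (f x - int_affine n (round c0) r x)\<^sup>2)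
      \<le> (\<Sum>x\<in>slice n k. 8 * (f x - (\<Sum>i=1..n. c i * x i))\<^sup>2 + 8 * (H x - \<mu>)\<^sup>2)"
  proof (intro sum_mono)
    fix x assume x: "x \<in> slice n k"
    let ?u = "f x - F x - c0"
    have "f x \<in> \<int>" using f x by (force simp: Pi_iff)
    moreover have "F x \<in> \<int>" using int_affine_Ints[OF x, of 0 r] by (simp add: int_affine_def F_def)
    ultimately have "f x - F x \<in> \<int>" by simp
    then obtain w where w: "f x - F x = of_int w" by (auto elim: Ints_cases)
    \<comment> \<open>Since \<open>f x - F x\<close> is an integer, \<open>c0\<close> is at least as
      far from it as from its own rounding. Rounding \<open>c0\<close> therefore at most doubles the
      error at \<open>x\<close>.\<close>
    have "\<bar>c0 - of_int (round c0)\<bar> \<le> \<bar>?u\<bar>"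
      using round_diff_minimal[of c0 w] w by (simp add: abs_minus_commute)
    then have 1: "(c0 - of_int (round c0))\<^sup>2 \<le> ?u\<^sup>2" by (simp add: abs_le_square_iff)
    have eq: "f x - int_affine n (round c0) r x = ?u + (c0 - of_int (round c0))"
      by (simp add: int_affine_def F_def)
    have "(f x - int_affine n (round c0) r x)\<^sup>2 \<le> 4 * ?u\<^sup>2"
      unfolding eq using square_add_le[of ?u "c0 - of_int (round c0)"] 1 by linarith
    moreover have "?u = (f x - (\<Sum>i=1..n. c i * x i)) + (H x - \<mu>)"
      unfolding split[OF x] by (simp add: c0_def)
    then have "?u\<^sup>2 \<le> 2 * (f x - (\<Sum>i=1..n. c i * x i))\<^sup>2 + 2 * (H x - \<mu>)\<^sup>2"
      by (simp only: square_add_le)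
    ultimately show "(f x - int_affine n (round c0) r x)\<^sup>2
        \<le> 8 * (f x - (\<Sum>i=1..n. c i * x i))\<^sup>2 + 8 * (H x - \<mu>)\<^sup>2" by linarith
  qed
  also have "\<dots> = 8 * (\<Sum>x\<in>slice n k. (f x - (\<Sum>i=1..n. c i * x i))\<^sup>2) + 8 * (\<Sum>x\<in>slice n k. (H x - \<mu>)\<^sup>2)"
    by (simp add: sum.distrib sum_distrib_left)
  also have "\<dots> \<le> 8 * (\<epsilon> * ?M) + 8 * (584 * (\<epsilon> * ?M))"
    using err var by (intro add_mono mult_left_mono) auto
  also have "\<dots> \<le> 9352 * \<epsilon> * ?M"
  proof -
    have "0 \<le> \<epsilon> * ?M" by (rule order_trans[OF _ err]) (simp add: sum_nonneg)
    then show ?thesis by simp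
  qed
  finally show ?thesis using r(1) that by blast
qed

section \<open>Size of the minority\<close>

definition swap_coords :: "nat \<Rightarrow> nat \<Rightarrow> nat \<Rightarrow> nat" where
  "swap_coords i j l = (if l = i then j else if l = j then i else l)"

lemma slice_comp_swap:
  assumes "x \<in> slice n k" "i \<in> {1..n}" "j \<in> {1..n}"
  shows "x \<circ> swap_coords i j \<in> slice n k"
  using assms by (intro slice_comp_involution) (auto simp: swap_coords_def)

lemma int_affine_swap:
  assumes ij: "i \<in> {1..n}" "j \<in> {1..n}" "i \<noteq> j"
  shows "int_affine n N r (x \<circ> swap_coords i j) = int_affine n N r x + of_int (r i - r j) * (x j - x i)"
proof -
  have "int_affine n N r (x \<circ> swap_coords i j) - int_affine n N r x
      = (\<Sum>l=1..n. of_int (r l) * (x (swap_coords i j l) - x l))"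
    by (simp add: int_affine_def sum_subtractf algebra_simps)
  also have "\<dots> = (\<Sum>l\<in>{i, j}. of_int (r l) * (x (swap_coords i j l) - x l))"
    using ij by (intro sum.mono_neutral_right) (auto simp: swap_coords_def)
  also have "\<dots> = of_int (r i - r j) * (x j - x i)"
    using ij by (simp add: swap_coords_def algebra_simps)
  finally show ?thesis by simp
qed

text \<open>Starting from a point with ones at \<open>i1\<close>, \<open>i2\<close> and zeros at
  \<open>j1\<close>, \<open>j2\<close>, the two swaps give the values \<open>a\<close>,
  \<open>a - u\<close>, \<open>a - v\<close>, \<open>a - u - v\<close> with \<open>u\<close> and
  \<open>v\<close> nonzero. If the first three lie in \<open>{0, 1}\<close> then
  \<open>u = v = 1\<close> or \<open>u = v = - 1\<close>, and the fourth is -1 or 2.\<close>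

lemma card_non_boolean_quad:
  assumes k: "2 \<le> k"
    and I: "i1 \<in> {1..n}" "i2 \<in> {1..n}" "j1 \<in> {1..n}" "j2 \<in> {1..n}"
    and dist: "distinct [i1, i2, j1, j2]"
    and r: "r i1 \<noteq> r j1" "r i2 \<noteq> r j2"
  shows "(n - 4) choose (k - 2)
    \<le> card {x \<in> slice n k. int_affine n N r x \<notin> {0, 1} \<and> x i1 \<noteq> x j1 \<and> x i2 \<noteq> x j2}"
proof -
  let ?P = "{x \<in> slice n k. (\<forall>i\<in>{i1, i2}. x i = 1) \<and> (\<forall>i\<in>{j1, j2}. x i = 0)}"
  let ?Q = "{x \<in> slice n k. int_affine n N r x \<notin> {0, 1} \<and> x i1 \<noteq> x j1 \<and> x i2 \<noteq> x j2}"
  let ?F = "int_affine n N r"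
  have P: "card ?P = (n - 4) choose (k - 2)"
    using card_slice_pattern[of "{i1, i2}" n "{j1, j2}" k] k I dist by (simp add: numeral_eq_Suc)
  have "\<exists>y. y \<in> ?Q \<and> (\<forall>l. l \<notin> {i1, i2, j1, j2} \<longrightarrow> y l = x l)" if x: "x \<in> ?P" for x
  proof -
    define s1 where "s1 = swap_coords i1 j1"
    define s2 where "s2 = swap_coords i2 j2"
    define u where "u = real_of_int (r i1 - r j1)"
    define v where "v = real_of_int (r i2 - r j2)"
    have uv: "u \<noteq> 0" "v \<noteq> 0" using r by (auto simp: u_def v_def)
    have xs: "x \<in> slice n k" "x i1 = 1" "x i2 = 1" "x j1 = 0" "x j2 = 0" using x by auto
    have mem: "x \<circ> s1 \<in> slice n k" "x \<circ> s2 \<in> slice n k" "x \<circ> s1 \<circ> s2 \<in> slice n k"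
      unfolding s1_def s2_def using xs(1) I by (auto intro!: slice_comp_swap)
    have "?F (x \<circ> s1) = ?F x - u" "?F (x \<circ> s2) = ?F x - v"
      using I dist xs unfolding s1_def s2_def u_def v_def by (subst int_affine_swap; simp)+
    moreover have "?F (x \<circ> s1 \<circ> s2) = ?F x - u - v"
    proof -
      have "?F (x \<circ> s1 \<circ> s2) = ?F (x \<circ> s1) + v * ((x \<circ> s1) j2 - (x \<circ> s1) i2)"
        using I dist unfolding s2_def v_def by (intro int_affine_swap) auto
      moreover have "(x \<circ> s1) j2 = 0" "(x \<circ> s1) i2 = 1"
        using xs dist by (auto simp: s1_def swap_coords_def)
      ultimately show ?thesis using \<open>?F (x \<circ> s1) = ?F x - u\<close> by simp
    qed
    ultimately have "?F x \<notin> {0, 1} \<or> ?F (x \<circ> s1) \<notin> {0, 1} \<or> ?F (x \<circ> s2) \<notin> {0, 1}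
        \<or> ?F (x \<circ> s1 \<circ> s2) \<notin> {0, 1}"
      using uv by auto
    then obtain y where y: "y \<in> {x, x \<circ> s1, x \<circ> s2, x \<circ> s1 \<circ> s2}" "?F y \<notin> {0, 1}" by blast
    have "y i1 \<noteq> y j1 \<and> y i2 \<noteq> y j2" "\<And>l. l \<notin> {i1, i2, j1, j2} \<Longrightarrow> y l = x l"
      using y(1) xs dist by (auto simp: s1_def s2_def swap_coords_def)
    moreover have "y \<in> slice n k" using y(1) xs mem by auto
    ultimately show ?thesis using y(2) by blast
  qed
  then have "\<forall>x\<in>?P. \<exists>y. y \<in> ?Q \<and> (\<forall>l. l \<notin> {i1, i2, j1, j2} \<longrightarrow> y l = x l)" by blast
  from bchoice[OF this] obtain \<phi>
    where \<phi>: "\<forall>x\<in>?P. \<phi> x \<in> ?Q \<and> (\<forall>l. l \<notin> {i1, i2, j1, j2} \<longrightarrow> \<phi> x l = x l)"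
    by (rule exE)
  \<comment> \<open>The starting points agree on the four coordinates, and the choice changes
    nothing elsewhere, so they can be recovered.\<close>
  have "inj_on \<phi> ?P"
  proof (rule inj_onI, rule ext)
    fix x y l assume x: "x \<in> ?P" and y: "y \<in> ?P" and eq: "\<phi> x = \<phi> y"
    show "x l = y l"
    proof (cases "l \<in> {i1, i2, j1, j2}")
      case True
      then show ?thesis using x y by auto
    next
      case False
      then have "\<phi> x l = x l" "\<phi> y l = y l" using \<phi> x y by blast+
      then show ?thesis using eq by simp
    qed
  qed
  moreover have "\<phi> ` ?P \<subseteq> ?Q" using \<phi> by blast
  ultimately have "card ?P \<le> card ?Q" by (intro card_inj_on_le) auto
  then show ?thesis using P by simp
qed

lemma sum_slice_ordered_split_pairs:
  assumes x: "x \<in> slice n k" and k: "k \<le> n"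
  shows "(\<Sum>i=1..n. \<Sum>j=1..n. of_bool (x i \<noteq> x j)) = 2 * real k * (real n - real k)"
proof -
  have "(\<Sum>i=1..n. \<Sum>j=1..n. of_bool (x i \<noteq> x j)) = (\<Sum>i=1..n. \<Sum>j=1..n. x i + x j - 2 * x i * x j)"
  proof (intro sum.cong refl)
    fix i j assume "i \<in> {1..n}" "j \<in> {1..n}"
    then show "of_bool (x i \<noteq> x j) = x i + x j - 2 * x i * x j"
      using slice_coord[OF x, of i] slice_coord[OF x, of j] by auto
  qed
  also have "\<dots> = (\<Sum>i=1..n. real n * x i + real k - 2 * x i * real k)"
    using x by (intro sum.cong refl)
      (simp add: sum.distrib sum_subtractf sum_distrib_left[symmetric] slice_def)
  also have "\<dots> = real n * real k + real n * real k - 2 * real k * real k"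
    using x by (simp add: sum.distrib sum_subtractf sum_distrib_left[symmetric]
      sum_distrib_right[symmetric] slice_def)
  finally show ?thesis by (simp add: algebra_simps)
qed

lemma binomial_drop_two_pairs:
  assumes "2 \<le> k" "k + 2 \<le> n"
  shows "real n * (real n - 1) * (real n - 2) * (real n - 3) * real ((n - 4) choose (k - 2))
    = real k * (real n - real k) * (real k - 1) * (real n - real k - 1) * real (n choose k)"
proof -
  have "real (n - 2) * (real (n - 2) - 1) * real ((n - 2 - 2) choose (k - 1 - 1))
      = real (k - 1) * (real (n - 2) - real (k - 1)) * real ((n - 2) choose (k - 1))"
    using assms by (intro binomial_drop_pair) auto
  then have 1: "(real n - 2) * (real n - 3) * real ((n - 4) choose (k - 2))
      = (real k - 1) * (real n - real k - 1) * real ((n - 2) choose (k - 1))"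
    using assms by (simp add: of_nat_diff numeral_eq_Suc)
  have 2: "real n * (real n - 1) * real ((n - 2) choose (k - 1)) = real k * (real n - real k) * real (n choose k)"
    using assms by (intro binomial_drop_pair) auto
  have "real n * (real n - 1) * (real n - 2) * (real n - 3) * real ((n - 4) choose (k - 2))
     = real n * (real n - 1) * ((real n - 2) * (real n - 3) * real ((n - 4) choose (k - 2)))"
    by (simp only: mult.assoc)
  also have "\<dots> = (real k - 1) * (real n - real k - 1) * (real n * (real n - 1) * real ((n - 2) choose (k - 1)))"
    unfolding 1 by (simp only: mult_ac)
  finally show ?thesis unfolding 2 by (simp only: mult_ac)
qed

text \<open>Double counting of pairs of disjoint swaps \<open>i1 \<leftrightarrow> j1\<close>, \<open>i2 \<leftrightarrow> j2\<close>, both of which change the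
  value of the affine function: among the four points they generate one is not Boolean.\<close>

lemma card_non_boolean_ge:
  fixes r :: "nat \<Rightarrow> int"
  assumes k: "2 \<le> k" "k + 2 \<le> n"
    and MR: "M \<subseteq> {1..n}" "R \<subseteq> {1..n}" "\<And>i j. i \<in> R \<Longrightarrow> j \<in> M \<Longrightarrow> r i \<noteq> r j"
  shows "real (card R) * (real (card R) - 1) * (real (card M) * (real (card M) - 1)) * real (n choose k)
    \<le> 16 * real n ^ 4 * real (card {x \<in> slice n k. int_affine n N r x \<notin> {0, 1}})"
proof -
  define bad where "bad = {x \<in> slice n k. int_affine n N r x \<notin> {0, 1}}"
  define b where "b = real ((n - 4) choose (k - 2))"
  define pairs where "pairs S = {(i, j). i \<in> S \<and> j \<in> S \<and> i \<noteq> j}" for S :: "nat set"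
  have fin: "finite M" "finite R" "finite bad"
    using finite_subset[OF MR(1)] finite_subset[OF MR(2)] by (simp_all add: bad_def)
  have card_pairs: "finite (pairs S)" "real (card (pairs S)) = real (card S) * (real (card S) - 1)"
    if "finite S" for S
  proof -
    have eq: "pairs S = (SIGMA i:S. S - {i})" by (auto simp: pairs_def)
    show "finite (pairs S)" unfolding eq using that by auto
    have "card (pairs S) = card S * (card S - 1)" unfolding eq using that by (simp add: card_SigmaI)
    then show "real (card (pairs S)) = real (card S) * (real (card S) - 1)"
      by (cases "card S") (auto simp: algebra_simps)
  qed
  define sp where "sp x i j = (of_bool (x i \<noteq> x j) :: real)" for x :: "nat \<Rightarrow> real" and i j :: nat
  have "real (card R) * (real (card R) - 1) * (real (card M) * (real (card M) - 1)) * b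
      = (\<Sum>(i1, i2)\<in>pairs R. \<Sum>(j1, j2)\<in>pairs M. b)"
    using fin by (simp add: card_pairs split_def)
  also have "\<dots> \<le> (\<Sum>(i1, i2)\<in>pairs R. \<Sum>(j1, j2)\<in>pairs M. \<Sum>x\<in>bad. sp x i1 j1 * sp x i2 j2)"
  proof (intro sum_mono, clarify, intro sum_mono, clarify)
    fix i1 i2 j1 j2 assume i: "(i1, i2) \<in> pairs R" and j: "(j1, j2) \<in> pairs M"
    have "real ((n - 4) choose (k - 2))
        \<le> real (card {x \<in> slice n k. int_affine n N r x \<notin> {0, 1} \<and> x i1 \<noteq> x j1 \<and> x i2 \<noteq> x j2})"
      unfolding of_nat_le_iff
      by (intro card_non_boolean_quad k(1)) (use i j MR in \<open>auto simp: pairs_def\<close>)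
    also have "{x \<in> slice n k. int_affine n N r x \<notin> {0, 1} \<and> x i1 \<noteq> x j1 \<and> x i2 \<noteq> x j2}
        = {x \<in> bad. x i1 \<noteq> x j1 \<and> x i2 \<noteq> x j2}" by (auto simp: bad_def)
    also have "real (card \<dots>) = (\<Sum>x\<in>bad. of_bool (x i1 \<noteq> x j1 \<and> x i2 \<noteq> x j2))"
      using fin by (simp add: of_bool_def sum.If_cases Int_def)
    also have "\<dots> = (\<Sum>x\<in>bad. sp x i1 j1 * sp x i2 j2)"
      by (intro sum.cong refl) (simp add: sp_def)
    finally show "b \<le> (\<Sum>x\<in>bad. sp x i1 j1 * sp x i2 j2)" by (simp add: b_def)
  qed
  \<comment> \<open>Enlarging to all index pairs adds nonnegative terms only, and turns the index
    sum for each \<open>x\<close> into the square of the number of ordered pairs on which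
    \<open>x\<close> differs.\<close>
  also have "\<dots> \<le> (\<Sum>(i1, i2)\<in>{1..n} \<times> {1..n}. \<Sum>(j1, j2)\<in>{1..n} \<times> {1..n}. \<Sum>x\<in>bad. sp x i1 j1 * sp x i2 j2)"
  proof -
    have "(\<Sum>(i1, i2)\<in>pairs R. \<Sum>(j1, j2)\<in>pairs M. \<Sum>x\<in>bad. sp x i1 j1 * sp x i2 j2)
        \<le> (\<Sum>(i1, i2)\<in>pairs R. \<Sum>(j1, j2)\<in>{1..n} \<times> {1..n}. \<Sum>x\<in>bad. sp x i1 j1 * sp x i2 j2)"
      by (intro sum_mono, clarify, intro sum_mono2)
        (use MR in \<open>auto simp: pairs_def sp_def intro!: sum_nonneg\<close>)
    also have "\<dots> \<le> (\<Sum>(i1, i2)\<in>{1..n} \<times> {1..n}. \<Sum>(j1, j2)\<in>{1..n} \<times> {1..n}. \<Sum>x\<in>bad. sp x i1 j1 * sp x i2 j2)"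
      by (intro sum_mono2) (use MR in \<open>auto simp: pairs_def sp_def intro!: sum_nonneg\<close>)
    finally show ?thesis .
  qed
  also have "\<dots> = (\<Sum>x\<in>bad. (\<Sum>i=1..n. \<Sum>j=1..n. sp x i j)\<^sup>2)"
  proof -
    have "(\<Sum>(i1, i2)\<in>{1..n} \<times> {1..n}. \<Sum>(j1, j2)\<in>{1..n} \<times> {1..n}. \<Sum>x\<in>bad. sp x i1 j1 * sp x i2 j2)
        = (\<Sum>p\<in>{1..n} \<times> {1..n}. \<Sum>x\<in>bad. \<Sum>q\<in>{1..n} \<times> {1..n}. sp x (fst p) (fst q) * sp x (snd p) (snd q))"
      unfolding split_def by (intro sum.cong refl sum.swap)
    also have "\<dots> = (\<Sum>x\<in>bad. \<Sum>p\<in>{1..n} \<times> {1..n}. \<Sum>q\<in>{1..n} \<times> {1..n}. sp x (fst p) (fst q) * sp x (snd p) (snd q))"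
      by (rule sum.swap)
    also have "\<dots> = (\<Sum>x\<in>bad. (\<Sum>i=1..n. \<Sum>j=1..n. sp x i j)\<^sup>2)"
    proof (intro sum.cong refl)
      fix x
      have prod: "(\<Sum>p\<in>{1..n} \<times> {1..n}. G p) = (\<Sum>i=1..n. \<Sum>j=1..n. G (i, j))"
        for G :: "nat \<times> nat \<Rightarrow> real"
        by (simp add: sum.cartesian_product)
      have "(\<Sum>p\<in>{1..n} \<times> {1..n}. \<Sum>q\<in>{1..n} \<times> {1..n}. sp x (fst p) (fst q) * sp x (snd p) (snd q))
          = (\<Sum>i1=1..n. \<Sum>i2=1..n. \<Sum>j1=1..n. \<Sum>j2=1..n. sp x i1 j1 * sp x i2 j2)"
        by (simp only: prod fst_conv snd_conv)
      also have "\<dots> = (\<Sum>i1=1..n. \<Sum>i2=1..n. (\<Sum>j=1..n. sp x i1 j) * (\<Sum>j=1..n. sp x i2 j))"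
        by (simp add: sum_product)
      also have "\<dots> = (\<Sum>i=1..n. \<Sum>j=1..n. sp x i j)\<^sup>2"
        by (simp only: power2_eq_square sum_product)
      finally show "(\<Sum>p\<in>{1..n} \<times> {1..n}. \<Sum>q\<in>{1..n} \<times> {1..n}. sp x (fst p) (fst q) * sp x (snd p) (snd q))
          = (\<Sum>i=1..n. \<Sum>j=1..n. sp x i j)\<^sup>2" .
    qed
    finally show ?thesis .
  qed
  also have "\<dots> = (\<Sum>x\<in>bad. (2 * real k * (real n - real k))\<^sup>2)"
    using k unfolding sp_def
    by (intro sum.cong refl) (subst sum_slice_ordered_split_pairs, auto simp: bad_def)
  finally have main: "real (card R) * (real (card R) - 1) * (real (card M) * (real (card M) - 1)) * b
      \<le> real (card bad) * (2 * real k * (real n - real k))\<^sup>2" by simp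
  define X where "X = real (card R) * (real (card R) - 1) * (real (card M) * (real (card M) - 1))"
  have X0: "0 \<le> X" unfolding X_def by (metis card_pairs(2) fin(1,2) of_nat_0_le_iff mult_nonneg_nonneg)
  define Y where "Y = real k * (real n - real k)"
  have n: "real n \<ge> 4" "real k \<ge> 2" "real n - real k \<ge> 2" using k by linarith+
  have Y: "Y > 0" using n by (simp add: Y_def)
  \<comment> \<open>Halving both factors costs 4, and the count \<open>2 * Y\<close> of ordered
    pairs, squared, costs another 4: together 16.\<close>
  have half: "Y / 4 \<le> (real k - 1) * (real n - real k - 1)"
  proof -
    have "real k / 2 * ((real n - real k) / 2) \<le> (real k - 1) * (real n - real k - 1)"
      using n by (intro mult_mono) auto
    then show ?thesis by (simp add: Y_def)
  qed
  have "X * (Y * (Y / 4) * real (n choose k))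
      \<le> X * (Y * ((real k - 1) * (real n - real k - 1)) * real (n choose k))"
    using X0 Y half by (intro mult_left_mono mult_right_mono) auto
  also have "\<dots> = X * (real n * (real n - 1) * (real n - 2) * (real n - 3) * b)"
    unfolding b_def binomial_drop_two_pairs[OF k] Y_def by (simp only: mult_ac)
  also have "\<dots> \<le> X * (real n ^ 4 * b)"
  proof -
    have "real n * (real n - 1) * (real n - 2) * (real n - 3) \<le> real n * real n * real n * real n"
      using n by (intro mult_mono) auto
    then show ?thesis using X0
      by (intro mult_left_mono mult_right_mono) (auto simp: power4_eq_xxxx b_def)
  qed
  also have "\<dots> = real n ^ 4 * (X * b)" by (simp only: mult_ac)
  also have "\<dots> \<le> real n ^ 4 * (real (card bad) * (2 * Y)\<^sup>2)"
    using main by (intro mult_left_mono) (simp_all add: X_def Y_def mult_ac)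
  finally have "(Y\<^sup>2 / 4) * (X * real (n choose k)) \<le> (Y\<^sup>2 / 4) * (16 * real n ^ 4 * real (card bad))"
    by (simp add: power2_eq_square algebra_simps)
  then have "X * real (n choose k) \<le> 16 * real n ^ 4 * real (card bad)"
    by (rule mult_left_le_imp_le) (use Y in simp)
  then show ?thesis by (simp only: X_def bad_def)
qed

text \<open>Otherwise both \<open>M\<close> and its complement have linear size, and
  \<open>card_non_boolean_ge\<close> makes the non-Boolean probability at least 1/9216. Here 9216 is
  16 times 576, and 576 is the product of 4, 8, 3, 6 from the bounds \<open>n / 4\<close>,
  \<open>n / 8\<close>, \<open>n / 3\<close>, \<open>n / 6\<close> on the four factors.\<close>

lemma minority_small:
  fixes r :: "nat \<Rightarrow> int"
  assumes k: "2 \<le> k" "k + 2 \<le> n"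
    and M: "M = {i \<in> {1..n}. r i = v}" "n \<le> 3 * card M"
    and bad: "real (card {x \<in> slice n k. int_affine n N r x \<notin> {0, 1}}) \<le> \<eta> * real (n choose k)"
    and \<eta>: "\<eta> < 1 / 9216"
  shows "4 * card ({1..n} - M) \<le> n"
proof (rule ccontr)
  let ?s = "real (card ({1..n} - M))" and ?m = "real (card M)" and ?C = "real (n choose k)"
  assume "\<not> 4 * card ({1..n} - M) \<le> n"
  then have "n < 4 * card ({1..n} - M)" "2 \<le> card ({1..n} - M)" "4 \<le> n" using k by linarith+
  then have s: "real n \<le> 4 * ?s" "?s \<ge> 2" "real n \<ge> 4" by linarith+
  have "2 \<le> card M" using M(2) k by linarith
  then have m: "real n \<le> 3 * ?m" "?m \<ge> 2" using M(2) by linarith+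
  have C: "?C > 0" using k by simp
  have "real n ^ 4 / 576 = (real n / 4 * (real n / 4 / 2)) * (real n / 3 * (real n / 3 / 2))"
    by (simp add: power4_eq_xxxx)
  also have "\<dots> \<le> (?s * (?s - 1)) * (?m * (?m - 1))"
  proof -
    have "real n / 4 \<le> ?s" "real n / 4 / 2 \<le> ?s - 1" "real n / 3 \<le> ?m" "real n / 3 / 2 \<le> ?m - 1"
      using s m by linarith+
    then show ?thesis by (intro mult_mono mult_nonneg_nonneg) simp_all
  qed
  finally have "real n ^ 4 / 576 * ?C \<le> ?s * (?s - 1) * (?m * (?m - 1)) * ?C"
    using C by (intro mult_right_mono) auto
  also have "\<dots> \<le> 16 * real n ^ 4 * real (card {x \<in> slice n k. int_affine n N r x \<notin> {0, 1}})"
    using M by (intro card_non_boolean_ge k) auto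
  also have "\<dots> \<le> 16 * real n ^ 4 * (\<eta> * ?C)"
    using bad by (intro mult_left_mono) auto
  finally have "(real n ^ 4 * ?C) * (1 / 576) \<le> (real n ^ 4 * ?C) * (16 * \<eta>)" by (simp add: mult_ac)
  moreover have "real n ^ 4 * ?C > 0" using s C by simp
  ultimately have "1 / 576 \<le> 16 * \<eta>" by (simp only: mult_le_cancel_left_pos)
  then show False using \<eta> by simp
qed

text \<open>Bounds the probability that \<open>s\<close> given coordinates all vanish. One more zero
  multiplies it by \<open>1 - y\<close> with \<open>y = k / (n - s)\<close>. Since
  \<open>y \<le> 2 / 3\<close> gives \<open>(1 - y) * (1 + 3 * y) \<ge> 1\<close>, this factor is at
  least \<open>exp (- (3 * y))\<close>, and \<open>n - s \<ge> 3 * n / 4\<close> turns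
  \<open>3 * y\<close> into at most \<open>4 * k / n\<close>.\<close>

lemma binomial_ratio_ge:
  assumes "2 * k \<le> n" "4 * s \<le> n" "0 < n"
  shows "exp (- (4 * real k * real s / real n)) * real (n choose k) \<le> real ((n - s) choose k)"
  using assms(2)
proof (induction s)
  case 0
  show ?case by simp
next
  case (Suc s)
  define y where "y = real k / real (n - s)"
  have m: "3 * real n / 4 \<le> real (n - s)" "0 < real (n - s)" "0 < real n" using Suc.prems by auto
  have "y \<le> real k / (3 * real n / 4)" unfolding y_def using m by (intro divide_left_mono) auto
  then have y1: "3 * y \<le> 4 * real k / real n" by simp
  also have "\<dots> \<le> 2" using assms m by (simp add: field_simps)
  finally have y2: "y \<le> 2 / 3" by simp
  have y0: "0 \<le> y" by (simp add: y_def)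
  have "exp (- (3 * y)) * (1 + 3 * y) \<le> exp (- (3 * y)) * exp (3 * y)"
    by (intro mult_left_mono exp_ge_add_one_self) auto
  also have "\<dots> = 1" by (simp add: exp_minus)
  also have "1 \<le> (1 - y) * (1 + 3 * y)"
  proof -
    have "y * (3 * y) \<le> y * 2" using y0 y2 by (intro mult_left_mono) auto
    then show ?thesis by (simp add: algebra_simps)
  qed
  finally have "exp (- (3 * y)) \<le> 1 - y" using y0 by (simp add: mult_le_cancel_right)
  moreover have "exp (- (4 * real k / real n)) \<le> exp (- (3 * y))" using y1 by simp
  ultimately have e: "exp (- (4 * real k / real n)) \<le> 1 - y" by linarith
  have "4 * s \<le> n" using Suc.prems by simp
  then have "k + s \<le> n" using assms(1) by linarith
  then have le: "k \<le> n - s" by simp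
  have "exp (- (4 * real k * real (Suc s) / real n)) * real (n choose k)
      = exp (- (4 * real k / real n)) * (exp (- (4 * real k * real s / real n)) * real (n choose k))"
  proof -
    have "- (4 * real k * real (Suc s) / real n) = - (4 * real k / real n) + - (4 * real k * real s / real n)"
      using m by (simp add: field_simps)
    then show ?thesis by (simp only: exp_add mult.assoc)
  qed
  also have "\<dots> \<le> exp (- (4 * real k / real n)) * real ((n - s) choose k)"
    using Suc by (intro mult_left_mono) auto
  also have "\<dots> \<le> (1 - y) * real ((n - s) choose k)"
    using e by (intro mult_right_mono) auto
  also have "\<dots> = real ((n - Suc s) choose k)"
    using binomial_drop_unchosen[OF le] m by (simp add: y_def field_simps)
  finally show ?case .
qed

section \<open>Sparse integer affine functions\<close>

lemma int_affine_pattern: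
  assumes "R \<subseteq> {1..n}" "\<And>i. i \<in> {1..n} - R \<Longrightarrow> r i = 0" "J \<subseteq> R"
    and "\<And>i. i \<in> J \<Longrightarrow> x i = 1" "\<And>i. i \<in> R - J \<Longrightarrow> x i = 0"
  shows "int_affine n N r x = of_int (N + (\<Sum>i\<in>J. r i))"
proof -
  have "(\<Sum>i=1..n. of_int (r i) * x i) = (\<Sum>i\<in>J. of_int (r i) * x i)"
  proof (rule sum.mono_neutral_right)
    show "\<forall>i\<in>{1..n} - J. of_int (r i) * x i = 0"
    proof
      fix i assume i: "i \<in> {1..n} - J"
      then show "of_int (r i) * x i = 0"
        using assms(2)[of i] assms(5)[of i] by (cases "i \<in> R") auto
    qed
  qed (use assms in auto)
  also have "\<dots> = (\<Sum>i\<in>J. of_int (r i))"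
    using assms(4) by (intro sum.cong) auto
  finally show ?thesis by (simp add: int_affine_def)
qed

text \<open>Prescribing \<open>x\<close> on all of \<open>R\<close> makes the witness classes
  disjoint: \<open>J\<close> is recovered as the set of ones inside \<open>R\<close>.\<close>

lemma card_patterns_le:
  assumes R: "R \<subseteq> {1..n}" and JJ: "\<J> \<subseteq> Pow R" "\<And>J. J \<in> \<J> \<Longrightarrow> card J = j" "j \<le> k"
    and X: "finite X" "\<And>J x. J \<in> \<J> \<Longrightarrow> x \<in> slice n k \<Longrightarrow> \<forall>i\<in>J. x i = 1 \<Longrightarrow>
      \<forall>i\<in>R - J. x i = 0 \<Longrightarrow> x \<in> X"
  shows "card \<J> * ((n - card R) choose (k - j)) \<le> card X"
proof -
  define P where "P J = {x \<in> slice n k. (\<forall>i\<in>J. x i = 1) \<and> (\<forall>i\<in>R - J. x i = 0)}" for J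
  have finR: "finite R" using R finite_subset by blast
  have finJ: "finite \<J>" using JJ(1) finR by (meson finite_Pow_iff finite_subset)
  have cP: "card (P J) = (n - card R) choose (k - j)" if J: "J \<in> \<J>" for J
  proof -
    have JR: "J \<subseteq> R" using J JJ by blast
    have "card (P J) = (n - card J - card (R - J)) choose (k - card J)"
      unfolding P_def using R JR J JJ by (intro card_slice_pattern) auto
    moreover have "card R = card J + card (R - J)"
      using JR finR by (metis card_Diff_subset card_mono finite_subset le_add_diff_inverse)
    ultimately show ?thesis using JJ(2)[OF J] by simp
  qed
  have PJ: "J = {i \<in> R. x i = 1}" if "J \<subseteq> R" and x: "x \<in> P J" for J x
  proof
    show "J \<subseteq> {i \<in> R. x i = 1}" using that by (auto simp: P_def)
    show "{i \<in> R. x i = 1} \<subseteq> J"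
    proof
      fix i assume i: "i \<in> {i \<in> R. x i = 1}"
      have "x i = 0" if "i \<in> R - J" using x that by (simp add: P_def)
      then show "i \<in> J" using i by force
    qed
  qed
  have disj: "P J \<inter> P J' = {}" if J: "J \<in> \<J>" "J' \<in> \<J>" "J \<noteq> J'" for J J'
  proof (rule ccontr)
    assume "P J \<inter> P J' \<noteq> {}"
    then obtain x where x: "x \<in> P J" "x \<in> P J'" by blast
    have "J \<subseteq> R" "J' \<subseteq> R" using J JJ by blast+
    then show False using PJ[OF _ x(1)] PJ[OF _ x(2)] J(3) by simp
  qed
  have "card \<J> * ((n - card R) choose (k - j)) = (\<Sum>J\<in>\<J>. card (P J))"
    using cP by simp
  also have "\<dots> = card (\<Union>J\<in>\<J>. P J)"
    by (rule card_UN_disjoint[symmetric]) (use finJ disj in \<open>auto simp: P_def\<close>)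
  also have "\<dots> \<le> card X"
    by (rule card_mono[OF X(1)]) (use X(2) in \<open>auto simp: P_def\<close>)
  finally show ?thesis .
qed

text \<open>Prescribing one more coordinate to be 1 costs at most a factor \<open>n / k\<close>,
  that is, one power of \<open>p\<close>.\<close>

lemma binomial_shift_ge:
  assumes "1 \<le> k" "m \<le> n"
  shows "real k * real (m choose k) \<le> real n * real (m choose (k - 1))"
proof -
  have "real k * real (m choose k) = real m * real ((m - 1) choose (k - 1))"
    using assms by (intro binomial_drop_chosen)
  also have "\<dots> \<le> real n * real (m choose (k - 1))"
    using assms by (intro mult_mono) (auto intro: binomial_right_mono)
  finally show ?thesis .
qed

text \<open>The difference is an integer, so its square is at least 1 wherever it is
  nonzero.\<close>

lemma card_disagree_le:
  assumes f: "f \<in> slice n k \<rightarrow> {0, 1}"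
  shows "real (card {x \<in> slice n k. f x \<noteq> int_affine n N r x})
    \<le> (\<Sum>x\<in>slice n k. (f x - int_affine n N r x)\<^sup>2)"
proof -
  let ?F = "int_affine n N r"
  have "real (card {x \<in> slice n k. f x \<noteq> ?F x}) = (\<Sum>x\<in>slice n k. if f x \<noteq> ?F x then 1 else 0)"
    by (simp add: sum.If_cases Int_def)
  also have "\<dots> \<le> (\<Sum>x\<in>slice n k. (f x - ?F x)\<^sup>2)"
  proof (intro sum_mono)
    fix x assume x: "x \<in> slice n k"
    have "f x = 0 \<or> f x = 1" using f x by blast
    then have "f x \<in> \<int>" by auto
    then have "f x - ?F x \<in> \<int>" using int_affine_Ints[OF x] by simp
    then obtain w where w: "f x - ?F x = of_int w" by (auto elim: Ints_cases)
    show "(if f x \<noteq> ?F x then 1 else 0) \<le> (f x - ?F x)\<^sup>2"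
    proof (cases "w = 0")
      case True
      then show ?thesis using w by simp
    next
      case False
      then have "1 \<le> w\<^sup>2" by (metis int_one_le_iff_zero_less zero_less_power2)
      then have "(1::real) \<le> (of_int w)\<^sup>2" by (metis of_int_1_le_iff of_int_power)
      then show ?thesis using w by simp
    qed
  qed
  finally show ?thesis .
qed

section \<open>Maxima and minima of coordinates as Boolean functions\<close>

lemma max_coord_boolean:
  assumes "finite S" "\<And>i. i \<in> S \<Longrightarrow> x i = 0 \<or> x i = 1"
  shows "max_coord S x = (if \<exists>i\<in>S. x i = 1 then 1 else 0)"
proof (cases "S = {}")
  case False
  then have "Max (x ` S) = (if \<exists>i\<in>S. x i = 1 then 1 else 0)"
    using assms by (intro Max_eqI) (force split: if_splits)+
  then show ?thesis using False by (simp add: max_coord_def)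
qed (simp add: max_coord_def)

lemma min_coord_boolean:
  assumes "finite S" "\<And>i. i \<in> S \<Longrightarrow> x i = 0 \<or> x i = 1"
  shows "min_coord S x = (if \<exists>i\<in>S. x i = 0 then 0 else 1)"
proof (cases "S = {}")
  case False
  then have "Min (x ` S) = (if \<exists>i\<in>S. x i = 0 then 0 else 1)"
    using assms by (intro Min_eqI) (force split: if_splits)+
  then show ?thesis using False by (simp add: min_coord_def)
qed (simp add: min_coord_def)

lemma max_coord_slice:
  assumes "S \<subseteq> {1..n}" "x \<in> slice n k"
  shows "max_coord S x = (if \<exists>i\<in>S. x i = 1 then 1 else 0)"
proof (rule max_coord_boolean)
  show "finite S" using finite_subset[OF assms(1)] by simp
  show "x i = 0 \<or> x i = 1" if "i \<in> S" for i
    using assms that by (intro slice_coord) auto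
qed

lemma min_coord_slice:
  assumes "S \<subseteq> {1..n}" "x \<in> slice n k"
  shows "min_coord S x = (if \<exists>i\<in>S. x i = 0 then 0 else 1)"
proof (rule min_coord_boolean)
  show "finite S" using finite_subset[OF assms(1)] by simp
  show "x i = 0 \<or> x i = 1" if "i \<in> S" for i
    using assms that by (intro slice_coord) auto
qed

lemma sum_eq_max_coord:
  assumes S: "S \<subseteq> {1..n}" and x: "x \<in> slice n k" and "(\<Sum>i\<in>S. x i) \<in> {0, 1}"
  shows "(\<Sum>i\<in>S. x i) = max_coord S x"
proof -
  have fin: "finite S" using S finite_subset by blast
  have x01: "x i = 0 \<or> x i = 1" if "i \<in> S" for i using slice_coord[OF x] S that by blast
  show ?thesis
  proof (cases "\<exists>i\<in>S. x i = 1")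
    case True
    then obtain i where i: "i \<in> S" "x i = 1" by blast
    have "x i \<le> (\<Sum>i\<in>S. x i)" using fin i x01 by (intro member_le_sum) force+
    then show ?thesis using assms True i by (auto simp: max_coord_slice[OF S x])
  next
    case False
    then have "\<forall>i\<in>S. x i = 0" using x01 by blast
    then show ?thesis by (simp add: max_coord_slice[OF S x])
  qed
qed

text \<open>A coordinate with coefficient other than \<open>0, 1\<close> and a pair of coordinates with coefficient
  \<open>1\<close> are witnesses of non-Booleanness as soon as the rest of \<open>R\<close> vanishes, which happens with
  probability at least \<open>\<kappa>\<close>.\<close>

lemma sparse_int_affine:
  fixes f :: "(nat \<Rightarrow> real) \<Rightarrow> real" and r :: "nat \<Rightarrow> int"
  assumes k: "2 \<le> k" "k \<le> n" and f: "f \<in> slice n k \<rightarrow> {0, 1}"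
    and R: "R = {i \<in> {1..n}. r i \<noteq> 0}"
    and \<kappa>: "0 < \<kappa>" "\<kappa> * real (n choose k) \<le> real ((n - card R) choose k)"
    and err: "(\<Sum>x\<in>slice n k. (f x - int_affine n 0 r x)\<^sup>2) \<le> \<eta> * real (n choose k)"
  shows "\<exists>S. S \<subseteq> {1..n} \<and> real (card S) \<le> max 1 (sqrt (8 * \<eta> / \<kappa>) / (real k / real n)) \<and>
    (\<Sum>x\<in>slice n k. (f x - max_coord S x)\<^sup>2) \<le> (1 + 1 / \<kappa>) * \<eta> * real (n choose k)"
proof -
  let ?F = "int_affine n 0 r" and ?C = "real (n choose k)" and ?p = "real k / real n"
  define bad where "bad = {x \<in> slice n k. f x \<noteq> ?F x}"
  define G where "G = {i \<in> {1..n}. r i = 1}"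
  define B where "B = {i \<in> {1..n}. r i \<noteq> 0 \<and> r i \<noteq> 1}"
  have n: "real n > 0" "real k \<ge> 2" and p: "?p > 0" using k by auto
  have C: "?C > 0" using k by simp
  have fin: "finite bad" "finite G" "finite B" by (auto simp: bad_def G_def B_def)
  have bad: "real (card bad) \<le> \<eta> * ?C"
    using card_disagree_le[OF f, of 0 r] err unfolding bad_def by linarith
  have RI: "R \<subseteq> {1..n}" and R0: "\<And>i. i \<in> {1..n} - R \<Longrightarrow> r i = 0" using R by auto
  have pat: "x \<in> bad" if J: "J \<subseteq> R" "(\<Sum>i\<in>J. r i) \<notin> {0, 1}" and x: "x \<in> slice n k"
    "\<forall>i\<in>J. x i = 1" "\<forall>i\<in>R - J. x i = 0" for J x
  proof -
    have "?F x = of_int (0 + (\<Sum>i\<in>J. r i))"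
      using x by (intro int_affine_pattern[OF RI R0 J(1)]) auto
    then have "?F x \<notin> {0, 1}" using J(2)
      by (metis add_0 empty_iff insert_iff of_int_0 of_int_1 of_int_eq_iff)
    moreover have "f x \<in> {0, 1}" using f x by blast
    ultimately show ?thesis using x by (auto simp: bad_def)
  qed
  have c1: "\<kappa> * ?p * ?C \<le> real ((n - card R) choose (k - 1))"
  proof -
    have "real k * (\<kappa> * ?C) \<le> real k * real ((n - card R) choose k)"
      using \<kappa> by (intro mult_left_mono) auto
    also have "\<dots> \<le> real n * real ((n - card R) choose (k - 1))"
      using k by (intro binomial_shift_ge) auto
    finally show ?thesis using n by (simp add: field_simps)
  qed
  have c2: "\<kappa> * ?p\<^sup>2 / 2 * ?C \<le> real ((n - card R) choose (k - 2))"
  proof -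
    have "real k / 2 * (real k * (\<kappa> * ?C)) \<le> (real k - 1) * (real k * (\<kappa> * ?C))"
      using n \<kappa> C by (intro mult_right_mono) auto
    also have "\<dots> \<le> (real k - 1) * (real n * real ((n - card R) choose (k - 1)))"
      using c1 n by (intro mult_left_mono) (auto simp: field_simps)
    also have "\<dots> = real n * (real (k - 1) * real ((n - card R) choose (k - 1)))"
      using k by (simp add: of_nat_diff)
    also have "\<dots> \<le> real n * (real n * real ((n - card R) choose (k - 1 - 1)))"
      using k by (intro mult_left_mono binomial_shift_ge) auto
    finally show ?thesis using n by (simp add: field_simps power2_eq_square numeral_2_eq_2)
  qed
  \<comment> \<open>If \<open>i \<in> B\<close> is the only one inside \<open>R\<close>, the affine
    function takes the value \<open>r i\<close>, which is not Boolean.\<close>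
  have "card ((\<lambda>i. {i}) ` B) * ((n - card R) choose (k - 1)) \<le> card bad"
    by (rule card_patterns_le[OF RI _ _ _ fin(1) pat]) (use k in \<open>auto simp: B_def R\<close>)
  then have "real (card B * ((n - card R) choose (k - 1))) \<le> real (card bad)"
    by (simp only: of_nat_le_iff) (simp add: card_image)
  then have "real (card B) * (\<kappa> * ?p * ?C) \<le> \<eta> * ?C"
    using mult_left_mono[OF c1, of "real (card B)"] bad by simp
  then have "real (card B) * (\<kappa> * ?p) * ?C \<le> \<eta> * ?C" by (simp only: mult.assoc)
  then have "real (card B) * (\<kappa> * ?p) \<le> \<eta>" using C by (simp only: mult_le_cancel_right_pos)
  then have B: "real (card B) * ?p \<le> \<eta> / \<kappa>" using \<kappa> by (simp add: field_simps)
  have "card {J. J \<subseteq> G \<and> card J = 2} * ((n - card R) choose (k - 2)) \<le> card bad"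
  proof (rule card_patterns_le[OF RI _ _ _ fin(1) pat])
    show "{J. J \<subseteq> G \<and> card J = 2} \<subseteq> Pow R" by (auto simp: G_def R)
    fix J assume J: "J \<in> {J. J \<subseteq> G \<and> card J = 2}"
    then have "(\<Sum>i\<in>J. r i) = (\<Sum>i\<in>J. 1)" by (intro sum.cong) (auto simp: G_def)
    then show "(\<Sum>i\<in>J. r i) \<notin> {0, 1}" using J by simp
    show "J \<subseteq> R" using J by (auto simp: G_def R)
  qed (use k in auto)
  then have "real ((card G choose 2) * ((n - card R) choose (k - 2))) \<le> real (card bad)"
    by (simp only: of_nat_le_iff) (simp add: n_subsets fin)
  then have "real (card G choose 2) * (\<kappa> * ?p\<^sup>2 / 2 * ?C) \<le> \<eta> * ?C"
    using mult_left_mono[OF c2, of "real (card G choose 2)"] bad by simp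
  then have "real (card G choose 2) * (\<kappa> * ?p\<^sup>2 / 2) * ?C \<le> \<eta> * ?C" by (simp only: mult.assoc)
  then have G2: "real (card G choose 2) * (\<kappa> * ?p\<^sup>2 / 2) \<le> \<eta>"
    using C by (simp only: mult_le_cancel_right_pos)
  \<comment> \<open>From two elements on, the number of pairs is at least
    \<open>(card G)^2 / 4\<close>, and each pair weighs \<open>\<kappa> * p^2 / 2\<close>; solving
    for \<open>card G\<close> gives the square root and the 8. A single coordinate forms no pair,
    hence the maximum with 1.\<close>
  have G: "real (card G) \<le> max 1 (sqrt (8 * \<eta> / \<kappa>) / ?p)"
  proof (cases "card G \<le> 1")
    case False
    then have g: "real (card G) \<ge> 2" by simp
    have "real (card G choose 2) = real (card G) * (real (card G) - 1) / 2"
      using False by (simp add: choose_two real_of_nat_div of_nat_diff)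
    moreover have "real (card G) * (real (card G) / 2) \<le> real (card G) * (real (card G) - 1)"
      using g by (intro mult_left_mono) auto
    ultimately have "(real (card G))\<^sup>2 / 4 \<le> real (card G choose 2)"
      by (simp add: power2_eq_square)
    then have "(real (card G))\<^sup>2 / 4 * (\<kappa> * ?p\<^sup>2 / 2) \<le> real (card G choose 2) * (\<kappa> * ?p\<^sup>2 / 2)"
      using \<kappa> by (intro mult_right_mono) auto
    with G2 have "(real (card G))\<^sup>2 / 4 * (\<kappa> * ?p\<^sup>2 / 2) \<le> \<eta>" by linarith
    then have "(real (card G) * ?p)\<^sup>2 * \<kappa> \<le> 8 * \<eta>" unfolding power_mult_distrib by (simp add: mult_ac)
    then have "(real (card G) * ?p)\<^sup>2 \<le> 8 * \<eta> / \<kappa>" using \<kappa> by (simp only: pos_le_divide_eq)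
    then have "real (card G) * ?p \<le> sqrt (8 * \<eta> / \<kappa>)" by (rule real_le_rsqrt)
    then have "real (card G) \<le> sqrt (8 * \<eta> / \<kappa>) / ?p" using p by (simp only: pos_le_divide_eq)
    then show ?thesis by simp
  qed simp
  have GI: "G \<subseteq> {1..n}" by (auto simp: G_def)
  \<comment> \<open>Outside \<open>bad\<close>, and with \<open>B\<close> vanishing,
    \<open>f\<close> equals the sum over \<open>G\<close>; being Boolean, this sum is the maximum. A
    one in \<open>B\<close> has total probability at most \<open>card B * p\<close>, hence at most
    \<open>\<eta> / \<kappa>\<close>.\<close>
  have "(\<Sum>x\<in>slice n k. (f x - max_coord G x)\<^sup>2)
      \<le> (\<Sum>x\<in>slice n k. (if x \<in> bad then 1 else 0) + (\<Sum>i\<in>B. x i))"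
  proof (intro sum_mono)
    fix x assume x: "x \<in> slice n k"
    have f01: "f x = 0 \<or> f x = 1" using f x by blast
    have "max_coord G x = 0 \<or> max_coord G x = 1" by (simp add: max_coord_slice[OF GI x])
    with f01 have le1: "(f x - max_coord G x)\<^sup>2 \<le> 1" by auto
    have x01: "x i = 0 \<or> x i = 1" if "i \<in> B" for i using slice_coord[OF x] that by (simp add: B_def)
    have B0: "0 \<le> (\<Sum>i\<in>B. x i)" using x01 by (intro sum_nonneg) force
    consider "x \<in> bad" | i where "i \<in> B" "x i = 1" | "x \<notin> bad" "\<And>i. i \<in> B \<Longrightarrow> x i = 0"
      using x01 by blast
    then show "(f x - max_coord G x)\<^sup>2 \<le> (if x \<in> bad then 1 else 0) + (\<Sum>i\<in>B. x i)"
    proof cases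
      case 1
      then show ?thesis using le1 B0 by simp
    next
      case 2
      have "x i \<le> (\<Sum>i\<in>B. x i)" using fin 2 x01 by (intro member_le_sum) force+
      then show ?thesis using 2 le1 by simp
    next
      case 3
      have "?F x = (\<Sum>i\<in>G. of_int (r i) * x i)"
      proof -
        have "(\<Sum>i=1..n. of_int (r i) * x i) = (\<Sum>i\<in>G. of_int (r i) * x i)"
        proof (rule sum.mono_neutral_right)
          show "\<forall>i\<in>{1..n} - G. of_int (r i) * x i = 0"
          proof
            fix i assume "i \<in> {1..n} - G"
            then show "of_int (r i) * x i = 0"
              using 3(2)[of i] by (cases "r i = 0") (auto simp: G_def B_def)
          qed
        qed (auto simp: G_def)
        then show ?thesis by (simp add: int_affine_def)
      qed
      also have "\<dots> = (\<Sum>i\<in>G. x i)" by (intro sum.cong) (auto simp: G_def)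
      finally have "f x = (\<Sum>i\<in>G. x i)" using 3(1) x by (simp add: bad_def)
      moreover from this have "(\<Sum>i\<in>G. x i) \<in> {0, 1}" using f01 by auto
      ultimately have "f x = max_coord G x" using sum_eq_max_coord[OF GI x] by simp
      then show ?thesis using B0 by simp
    qed
  qed
  also have "\<dots> = real (card bad) + (\<Sum>i\<in>B. \<Sum>x\<in>slice n k. x i)"
  proof -
    have "{x \<in> slice n k. x \<in> bad} = bad" by (auto simp: bad_def)
    moreover have "(\<Sum>x\<in>slice n k. \<Sum>i\<in>B. x i) = (\<Sum>i\<in>B. \<Sum>x\<in>slice n k. x i)" by (rule sum.swap)
    ultimately show ?thesis by (simp add: sum.distrib sum.If_cases Int_def)
  qed
  also have "(\<Sum>i\<in>B. \<Sum>x\<in>slice n k. x i) = (\<Sum>i\<in>B. ?p * ?C)"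
  proof (intro sum.cong refl)
    fix i assume "i \<in> B"
    then have "(\<Sum>x\<in>slice n k. x i) = real ((n - 1) choose (k - 1))"
      using k by (intro sum_slice_coord) (auto simp: B_def)
    then show "(\<Sum>x\<in>slice n k. x i) = ?p * ?C"
      using binomial_drop_chosen[of k n] k n by (simp add: field_simps)
  qed
  also have "real (card bad) + (\<Sum>i\<in>B. ?p * ?C) \<le> \<eta> * ?C + \<eta> / \<kappa> * ?C"
    using bad mult_right_mono[OF B, of ?C] C by simp
  also have "\<dots> = (1 + 1 / \<kappa>) * \<eta> * ?C" by (simp add: algebra_simps)
  finally show ?thesis using G GI by blast
qed

text \<open>The coordinates sum to \<open>k\<close>. This is used to bring the majority coefficient
  to 0.\<close>

lemma int_affine_shift:
  assumes "x \<in> slice n k"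
  shows "int_affine n N r x = int_affine n (N + v * int k) (\<lambda>i. r i - v) x"
proof -
  have "(\<Sum>i=1..n. of_int v * x i) = of_int v * real k"
    using assms by (simp add: sum_distrib_left[symmetric] slice_def)
  then show ?thesis by (simp add: int_affine_def sum_subtractf left_diff_distrib)
qed

text \<open>The variance of the affine function is at most 1 and at least of order
  \<open>k / n\<close> times \<open>card R\<close>. So all of \<open>R\<close> vanishes with
  probability at least \<open>exp (- 12)\<close>; there the function equals \<open>N\<close>, which
  must be Boolean because disagreement is rarer than that. The case \<open>N = 1\<close> reduces to
  \<open>1 - f\<close> with negated coefficients.\<close>

lemma max_coord_approx_of_zero_majority:
  fixes f :: "(nat \<Rightarrow> real) \<Rightarrow> real" and r :: "nat \<Rightarrow> int"
  assumes k: "2 \<le> k" "2 * k \<le> n" and f: "f \<in> slice n k \<rightarrow> {0, 1}"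
    and R: "R = {i \<in> {1..n}. r i \<noteq> 0}" "4 * card R \<le> n"
    and err: "(\<Sum>x\<in>slice n k. (f x - int_affine n N r x)\<^sup>2) \<le> \<eta> * real (n choose k)"
    and \<eta>: "\<eta> < exp (- 12)" "\<eta> < 1 / 9216"
  shows "\<exists>S. S \<subseteq> {1..n} \<and> real (card S) \<le> max 1 (sqrt (8 * \<eta> * exp 12) / (real k / real n)) \<and>
    ((\<Sum>x\<in>slice n k. (f x - max_coord S x)\<^sup>2) \<le> (1 + exp 12) * \<eta> * real (n choose k) \<or>
     (\<Sum>x\<in>slice n k. ((1 - f x) - max_coord S x)\<^sup>2) \<le> (1 + exp 12) * \<eta> * real (n choose k))"
proof -
  let ?C = "real (n choose k)" and ?s = "real (card R)" and ?F = "int_affine n N r"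
  define Q where "Q = (\<Sum>i=1..n. (real_of_int (r i))\<^sup>2)"
  define q where "q = real k * (real n - real k) / (real n * (real n - 1))"
  have kn: "1 \<le> k" "k \<le> n" using k by auto
  have n: "real n \<ge> 4" "real k \<ge> 2" "2 * real k \<le> real n" using k by linarith+
  have C: "?C > 0" using k by simp
  have finR: "finite R" using R by simp
  have RI: "R \<subseteq> {1..n}" and R0: "\<And>i. i \<in> {1..n} - R \<Longrightarrow> r i = 0" using R by auto
  have QR: "Q = (\<Sum>i\<in>R. (real_of_int (r i))\<^sup>2)"
    unfolding Q_def using R by (intro sum.mono_neutral_right) auto
  have Qs: "?s \<le> Q"
  proof -
    have "(\<Sum>i\<in>R. 1) \<le> (\<Sum>i\<in>R. (real_of_int (r i))\<^sup>2)"
    proof (intro sum_mono)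
      fix i assume "i \<in> R"
      then have "0 < (r i)\<^sup>2" using R by simp
      then have "1 \<le> (r i)\<^sup>2" by linarith
      then show "1 \<le> (real_of_int (r i))\<^sup>2" by (metis of_int_1_le_iff of_int_power)
    qed
    then show ?thesis by (simp add: QR)
  qed
  have "(\<Sum>i=1..n. real_of_int (r i)) = (\<Sum>i\<in>R. real_of_int (r i))"
    using R by (intro sum.mono_neutral_right) auto
  \<comment> \<open>Cauchy-Schwarz on the support: with \<open>card R \<le> n / 4\<close> the square
    of the sum, divided by \<open>n\<close>, takes off at most a quarter of
    \<open>Q\<close>.\<close>
  then have "(\<Sum>i=1..n. real_of_int (r i))\<^sup>2 \<le> Q * ?s"
    using sum_squared_le_sum_of_squares[of "\<lambda>i. real_of_int (r i)" R] finR by (simp add: QR)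
  also have "\<dots> \<le> Q * (real n / 4)"
    using R(2) Qs by (intro mult_left_mono) auto
  finally have mean: "(\<Sum>i=1..n. real_of_int (r i))\<^sup>2 / real n \<le> Q / 4"
    using n by (simp add: field_simps)
  have q: "real k / real n / 2 \<le> q"
  proof -
    have "1 / 2 \<le> (real n - real k) / (real n - 1)" using n by (simp add: field_simps)
    then have "real k / real n * (1 / 2) \<le> real k / real n * ((real n - real k) / (real n - 1))"
      by (intro mult_left_mono) auto
    then show ?thesis by (simp add: q_def)
  qed
  have q0: "0 \<le> q" by (rule order_trans[OF _ q]) simp
  have "?C * (q * (3 / 4 * ?s)) \<le> ?C * (q * (Q - (\<Sum>i=1..n. real_of_int (r i))\<^sup>2 / real n))"
    using C q0 mean Qs by (intro mult_left_mono) auto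
  also have "\<dots> = (\<Sum>x\<in>slice n k. ((\<Sum>i=1..n. of_int (r i) * x i)
      - real k / real n * (\<Sum>i=1..n. of_int (r i)))\<^sup>2)"
    unfolding slice_variance[OF k(1) kn(2)] by (simp add: Q_def q_def)
  \<comment> \<open>The centre is chosen so that the deviation compares with
    \<open>f x - 1 / 2\<close>, whose square is always 1/4.\<close>
  also have "\<dots> \<le> (\<Sum>x\<in>slice n k. ((\<Sum>i=1..n. of_int (r i) * x i) - (1 / 2 - of_int N))\<^sup>2)"
    by (rule slice_variance_le[OF kn])
  also have "\<dots> \<le> (\<Sum>x\<in>slice n k. 2 * (f x - ?F x)\<^sup>2 + 1 / 2)"
  proof (intro sum_mono)
    fix x assume "x \<in> slice n k"
    then have "f x = 0 \<or> f x = 1" using f by blast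
    then have "(f x - 1 / 2)\<^sup>2 = 1 / 4" by (auto simp: power2_eq_square)
    moreover have eq: "(\<Sum>i=1..n. of_int (r i) * x i) - (1 / 2 - of_int N) = (f x - 1 / 2) - (f x - ?F x)"
      by (simp add: int_affine_def)
    ultimately show "((\<Sum>i=1..n. of_int (r i) * x i) - (1 / 2 - of_int N))\<^sup>2
        \<le> 2 * (f x - ?F x)\<^sup>2 + 1 / 2"
      unfolding eq using square_diff_le[of "f x - 1 / 2" "f x - ?F x"] by linarith
  qed
  also have "\<dots> = 2 * (\<Sum>x\<in>slice n k. (f x - ?F x)\<^sup>2) + ?C / 2"
    by (simp add: sum.distrib sum_distrib_left card_slice)
  also have "\<dots> \<le> 2 * (\<eta> * ?C) + ?C / 2" using err by simp
  also have "\<dots> \<le> ?C * 1"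
  proof -
    have "\<eta> * ?C \<le> 1 / 9216 * ?C" using \<eta>(2) C by (intro mult_right_mono) auto
    then show ?thesis using C by linarith
  qed
  finally have q1: "q * (3 / 4 * ?s) \<le> 1" using C by (simp only: mult_le_cancel_left_pos)
  \<comment> \<open>This yields 32/3, rounded up to the 12 in the exponent.\<close>
  have "3 / 32 * (4 * real k * ?s / real n) = real k / real n / 2 * (3 / 4 * ?s)" by simp
  also have "\<dots> \<le> q * (3 / 4 * ?s)"
    using q by (intro mult_right_mono) auto
  also note q1
  finally have ps: "4 * real k * ?s / real n \<le> 12" using n by (simp add: field_simps)
  have "exp (- 12) * ?C \<le> exp (- (4 * real k * ?s / real n)) * ?C"
    using ps by (intro mult_right_mono) auto
  also have "\<dots> \<le> real ((n - card R) choose k)"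
    using k R(2) by (intro binomial_ratio_ge) auto
  finally have \<kappa>: "exp (- 12) * ?C \<le> real ((n - card R) choose k)" .
  have inv: "8 * \<eta> / exp (- 12) = 8 * \<eta> * exp 12" "1 / exp (- 12) = exp (12 :: real)"
    by (simp_all add: exp_minus field_simps)
  have "N = 0 \<or> N = 1"
  proof (rule ccontr)
    assume N: "\<not> (N = 0 \<or> N = 1)"
    define bad where "bad = {x \<in> slice n k. f x \<noteq> ?F x}"
    have "card {{}::nat set} * ((n - card R) choose (k - 0)) \<le> card bad"
    proof (rule card_patterns_le[OF RI])
      show "finite bad" by (simp add: bad_def)
      fix J x assume J: "J \<in> {{}::nat set}" and x: "x \<in> slice n k" "\<forall>i\<in>R - J. x i = 0"
      have "?F x = of_int (N + (\<Sum>i\<in>{}. r i))"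
        using x J by (intro int_affine_pattern[OF RI R0]) auto
      moreover have "f x = 0 \<or> f x = 1" using f x by blast
      ultimately show "x \<in> bad" using x N by (auto simp: bad_def)
    qed auto
    then have "real ((n - card R) choose k) \<le> real (card bad)" by simp
    also have "\<dots> \<le> \<eta> * ?C" using card_disagree_le[OF f, of N r] err unfolding bad_def by linarith
    finally have "exp (- 12) * ?C \<le> \<eta> * ?C" using \<kappa> by linarith
    then show False using C \<eta>(1) by simp
  qed
  then show ?thesis
  proof
    assume "N = 0"
    then show ?thesis
      using sparse_int_affine[OF k(1) kn(2) f R(1) _ \<kappa>, of \<eta>] err unfolding inv by auto
  next
    assume N: "N = 1"
    have "(\<Sum>x\<in>slice n k. ((1 - f x) - int_affine n 0 (\<lambda>i. - r i) x)\<^sup>2) \<le> \<eta> * ?C"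
    proof -
      have "(\<Sum>x\<in>slice n k. ((1 - f x) - int_affine n 0 (\<lambda>i. - r i) x)\<^sup>2)
          = (\<Sum>x\<in>slice n k. (f x - ?F x)\<^sup>2)"
      proof (intro sum.cong refl)
        fix x
        have "(1 - f x) - int_affine n 0 (\<lambda>i. - r i) x = - (f x - ?F x)"
          by (simp add: int_affine_def N sum_negf)
        then show "((1 - f x) - int_affine n 0 (\<lambda>i. - r i) x)\<^sup>2 = (f x - ?F x)\<^sup>2"
          by (simp only: power2_minus)
      qed
      then show ?thesis using err by simp
    qed
    moreover have "(\<lambda>x. 1 - f x) \<in> slice n k \<rightarrow> {0, 1}" using f by force
    moreover have "R = {i \<in> {1..n}. - r i \<noteq> 0}" using R by simp
    ultimately show ?thesis
      using sparse_int_affine[OF k(1) kn(2), of "\<lambda>x. 1 - f x" R "\<lambda>i. - r i" "exp (- 12)" \<eta>] \<kappa>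
      unfolding inv by auto
  qed
qed

section \<open>Choice of constants and complementation\<close>

lemma sqnorm_boolean_le:
  assumes "f \<in> slice n k \<rightarrow> {0, 1}"
  shows "(\<Sum>x\<in>slice n k. (f x)\<^sup>2) \<le> real (n choose k)"
proof -
  have "(\<Sum>x\<in>slice n k. (f x)\<^sup>2) \<le> (\<Sum>x\<in>slice n k. 1)"
  proof (intro sum_mono)
    fix x assume "x \<in> slice n k"
    then have "f x = 0 \<or> f x = 1" using assms by blast
    then show "(f x)\<^sup>2 \<le> 1" by auto
  qed
  then show ?thesis by (simp add: card_slice)
qed

lemma majority_of_three:
  fixes r :: "nat \<Rightarrow> int"
  assumes "\<And>i. r i \<in> {- 1, 0, 1}"
  obtains v where "n \<le> 3 * card {i \<in> {1..n}. r i = v}"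
proof (rule ccontr)
  assume "\<not> thesis"
  then have lt: "3 * card {i \<in> {1..n}. r i = v} < n" for v using that by (meson not_le)
  have "{1..n} = {i \<in> {1..n}. r i = - 1} \<union> {i \<in> {1..n}. r i = 0} \<union> {i \<in> {1..n}. r i = 1}"
    using assms by auto
  then have "n = card ({i \<in> {1..n}. r i = - 1} \<union> {i \<in> {1..n}. r i = 0} \<union> {i \<in> {1..n}. r i = 1})"
    by (metis card_atLeastAtMost diff_Suc_1)
  also have "\<dots> \<le> card {i \<in> {1..n}. r i = - 1} + card {i \<in> {1..n}. r i = 0} + card {i \<in> {1..n}. r i = 1}"
    using card_Un_le add_le_mono order_trans by (meson le_refl)
  finally show False using lt[of "- 1"] lt[of 0] lt[of 1] by linarith
qed

text \<open>The 100000 exceeds 74816 = 8 * 9352, the largest multiple of \<open>exp 12\<close>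
  required, where 9352 is the loss in \<open>int_affine_approx\<close>. The two summands make
  \<open>fkn_const * \<epsilon> < 1\<close> imply both thresholds on \<open>\<eta>\<close>,
  \<open>exp (- 12)\<close> and \<open>1 / 9216\<close>.\<close>

definition fkn_const :: real where
  "fkn_const = 100000 * (exp 12 + 9216)"

lemma fkn_const_ge_1: "1 \<le> fkn_const"
proof -
  have "1 \<le> 100000 * (e + 9216)" if "0 < e" for e :: real
    using that by simp
  then show ?thesis unfolding fkn_const_def by simp
qed

lemma max_coord_approx:
  fixes f :: "(nat \<Rightarrow> real) \<Rightarrow> real" and c :: "nat \<Rightarrow> real"
  assumes k: "2 \<le> k" "2 * k \<le> n" and f: "f \<in> slice n k \<rightarrow> {0, 1}"
    and err: "(\<Sum>x\<in>slice n k. (f x - (\<Sum>i=1..n. c i * x i))\<^sup>2) \<le> \<epsilon> * real (n choose k)"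
    and small: "fkn_const * \<epsilon> < 1"
  obtains S where "S \<subseteq> {1..n}" "real (card S) \<le> max 1 (fkn_const * sqrt \<epsilon> / (real k / real n))"
    "(\<Sum>x\<in>slice n k. (f x - max_coord S x)\<^sup>2) \<le> fkn_const * \<epsilon> * real (n choose k) \<or>
     (\<Sum>x\<in>slice n k. ((1 - f x) - max_coord S x)\<^sup>2) \<le> fkn_const * \<epsilon> * real (n choose k)"
proof -
  let ?C = "real (n choose k)" and ?A = fkn_const
  define \<eta> where "\<eta> = 9352 * \<epsilon>"
  have e: "0 < exp (12 :: real)" by simp
  have C: "?C > 0" using k by simp
  have "0 \<le> \<epsilon> * ?C" by (rule order_trans[OF _ err]) (simp add: sum_nonneg)
  then have \<epsilon>0: "0 \<le> \<epsilon>" using C by (simp add: zero_le_mult_iff)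
  obtain r N where r: "\<And>i. r i \<in> {- 1, 0, 1}"
    and F: "(\<Sum>x\<in>slice n k. (f x - int_affine n N r x)\<^sup>2) \<le> 9352 * \<epsilon> * ?C"
    by (rule int_affine_approx[OF k f err]) (rule that)
  obtain v where v: "n \<le> 3 * card {i \<in> {1..n}. r i = v}"
    by (rule majority_of_three[of r n, OF r])
  have "9352 * (exp 12 + 9216) * \<epsilon> \<le> ?A * \<epsilon>"
    using e \<epsilon>0 unfolding fkn_const_def by (intro mult_right_mono) auto
  then have "\<eta> * exp 12 + 9216 * \<eta> < 1" using small by (simp add: \<eta>_def algebra_simps)
  moreover have "0 \<le> \<eta> * exp 12" "0 \<le> \<eta>" using \<epsilon>0 by (simp_all add: \<eta>_def)
  ultimately have "\<eta> * exp 12 < 1" "\<eta> < 1 / 9216" by linarith+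
  then have \<eta>: "\<eta> < exp (- 12)" "\<eta> < 1 / 9216"
    using e by (simp_all add: exp_minus field_simps)
  have dis: "real (card {x \<in> slice n k. int_affine n N r x \<notin> {0, 1}}) \<le> \<eta> * ?C"
  proof -
    have "card {x \<in> slice n k. int_affine n N r x \<notin> {0, 1}} \<le> card {x \<in> slice n k. f x \<noteq> int_affine n N r x}"
      using f by (intro card_mono) force+
    then show ?thesis using card_disagree_le[OF f, of N r] F unfolding \<eta>_def by linarith
  qed
  define R where "R = {i \<in> {1..n}. r i - v \<noteq> 0}"
  have "{1..n} - {i \<in> {1..n}. r i = v} = R" by (auto simp: R_def)
  then have R4: "4 * card R \<le> n"
    using minority_small[OF k(1) _ refl v dis \<eta>(2)] k by simp
  have "(\<Sum>x\<in>slice n k. (f x - int_affine n (N + v * int k) (\<lambda>i. r i - v) x)\<^sup>2) \<le> \<eta> * ?C"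
    using F by (simp add: \<eta>_def int_affine_shift[symmetric])
  from max_coord_approx_of_zero_majority[OF k f R_def R4 this \<eta>]
  obtain S where S: "S \<subseteq> {1..n}" "real (card S) \<le> max 1 (sqrt (8 * \<eta> * exp 12) / (real k / real n))"
    and app: "(\<Sum>x\<in>slice n k. (f x - max_coord S x)\<^sup>2) \<le> (1 + exp 12) * \<eta> * ?C \<or>
     (\<Sum>x\<in>slice n k. ((1 - f x) - max_coord S x)\<^sup>2) \<le> (1 + exp 12) * \<eta> * ?C"
    by blast
  have "sqrt (8 * \<eta> * exp 12) \<le> ?A * sqrt \<epsilon>"
  proof -
    have "74816 * exp 12 \<le> ?A" using e unfolding fkn_const_def by (simp add: algebra_simps)
    also have "\<dots> \<le> ?A * ?A" using fkn_const_ge_1 by simp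
    finally have "74816 * exp 12 * \<epsilon> \<le> ?A * ?A * \<epsilon>" using \<epsilon>0 by (intro mult_right_mono)
    then have "sqrt (8 * \<eta> * exp 12) \<le> sqrt (?A\<^sup>2 * \<epsilon>)"
      by (simp add: \<eta>_def power2_eq_square mult_ac)
    also have "\<dots> = ?A * sqrt \<epsilon>" using fkn_const_ge_1 by (simp add: real_sqrt_mult)
    finally show ?thesis .
  qed
  then have "sqrt (8 * \<eta> * exp 12) / (real k / real n) \<le> ?A * sqrt \<epsilon> / (real k / real n)"
    by (intro divide_right_mono) auto
  then have "real (card S) \<le> max 1 (?A * sqrt \<epsilon> / (real k / real n))" using S(2) by linarith
  moreover have "(1 + exp 12) * \<eta> * ?C \<le> ?A * \<epsilon> * ?C"
  proof -
    have "(1 + exp 12) * 9352 \<le> ?A" using e unfolding fkn_const_def by (simp add: algebra_simps)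
    then have "(1 + exp 12) * 9352 * (\<epsilon> * ?C) \<le> ?A * (\<epsilon> * ?C)"
      using \<epsilon>0 C by (intro mult_right_mono) auto
    then show ?thesis by (simp add: \<eta>_def mult_ac)
  qed
  ultimately show ?thesis using S(1) app by (intro that[of S]) auto
qed

section \<open>Complementation between the slices \<open>k\<close> and \<open>n - k\<close>\<close>

definition slice_compl :: "nat \<Rightarrow> (nat \<Rightarrow> real) \<Rightarrow> nat \<Rightarrow> real" where
  "slice_compl n x = restrict (\<lambda>i. 1 - x i) {1..n}"

lemma slice_compl_mem:
  assumes x: "x \<in> slice n k" and "k \<le> n"
  shows "slice_compl n x \<in> slice n (n - k)"
proof -
  have "(\<Sum>i=1..n. slice_compl n x i) = (\<Sum>i=1..n. 1 - x i)"
    by (intro sum.cong) (auto simp: slice_compl_def)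
  also have "\<dots> = real (n - k)" using assms by (simp add: sum_subtractf slice_def of_nat_diff)
  finally show ?thesis using slice_coord[OF x] by (force simp: slice_def slice_compl_def)
qed

lemma slice_compl_compl:
  assumes "x \<in> slice n k"
  shows "slice_compl n (slice_compl n x) = x"
  using assms by (auto simp: slice_compl_def slice_def PiE_iff extensional_def fun_eq_iff)

lemma sum_slice_compl:
  assumes k: "k \<le> n"
  shows "(\<Sum>y\<in>slice n (n - k). h (slice_compl n y)) = (\<Sum>x\<in>slice n k. h x)"
  by (rule sum.reindex_bij_witness[of _ "slice_compl n" "slice_compl n"])
    (use slice_compl_mem[of _ n k] slice_compl_mem[of _ n "n - k"] slice_compl_compl k in auto)

lemma max_coord_slice_compl:
  assumes S: "S \<subseteq> {1..n}" and x: "x \<in> slice n k" and k: "k \<le> n"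
  shows "max_coord S (slice_compl n x) = 1 - min_coord S x"
proof -
  have "slice_compl n x i = 1 \<longleftrightarrow> x i = 0" if "i \<in> S" for i
    using S that by (auto simp: slice_compl_def)
  then show ?thesis
    unfolding max_coord_slice[OF S slice_compl_mem[OF x k]] min_coord_slice[OF S x] by simp
qed

lemma slice_sqnorm_le_iff:
  assumes "k \<le> n"
  shows "slice_sqnorm n k h \<le> \<epsilon> \<longleftrightarrow> (\<Sum>x\<in>slice n k. (h x)\<^sup>2) \<le> \<epsilon> * real (n choose k)"
  using assms by (simp add: slice_sqnorm_eq pos_divide_le_eq)

text \<open>Complementing the point turns a maximum into 1 minus a minimum, so the alternatives for
  \<open>f\<close> and \<open>1 - f\<close> change places.\<close>

lemma min_coord_approx:
  fixes f :: "(nat \<Rightarrow> real) \<Rightarrow> real" and c :: "nat \<Rightarrow> real"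
  assumes k: "k + 2 \<le> n" "n \<le> 2 * k" and f: "f \<in> slice n k \<rightarrow> {0, 1}"
    and err: "(\<Sum>x\<in>slice n k. (f x - (\<Sum>i=1..n. c i * x i))\<^sup>2) \<le> \<epsilon> * real (n choose k)"
    and small: "fkn_const * \<epsilon> < 1"
  obtains S where "S \<subseteq> {1..n}" "real (card S) \<le> max 1 (fkn_const * sqrt \<epsilon> / (1 - real k / real n))"
    "(\<Sum>x\<in>slice n k. (f x - min_coord S x)\<^sup>2) \<le> fkn_const * \<epsilon> * real (n choose k) \<or>
     (\<Sum>x\<in>slice n k. ((1 - f x) - min_coord S x)\<^sup>2) \<le> fkn_const * \<epsilon> * real (n choose k)"
proof -
  have kn: "k \<le> n" using k by simp
  define f' where "f' y = f (slice_compl n y)" for y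
  \<comment> \<open>Complementing creates the constant sum of the \<open>c i\<close>; on the slice
    \<open>n - k\<close> it is spread evenly over the coefficients, which keeps the function
    linear.\<close>
  define c' where "c' i = (\<Sum>i=1..n. c i) / real (n - k) - c i" for i
  have sym: "n choose (n - k) = n choose k" using kn by (rule binomial_symmetric[symmetric])
  have f': "f' \<in> slice n (n - k) \<rightarrow> {0, 1}"
    using f slice_compl_mem[of _ n "n - k"] kn by (auto simp: f'_def Pi_iff)
  have lin: "(\<Sum>i=1..n. c' i * y i) = (\<Sum>i=1..n. c i * slice_compl n y i)" if y: "y \<in> slice n (n - k)" for y
  proof -
    have "(\<Sum>i=1..n. c' i * y i) = (\<Sum>i=1..n. c i) / real (n - k) * (\<Sum>i=1..n. y i) - (\<Sum>i=1..n. c i * y i)"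
      by (simp add: c'_def left_diff_distrib sum_subtractf sum_distrib_left)
    also have "\<dots> = (\<Sum>i=1..n. c i) - (\<Sum>i=1..n. c i * y i)"
      using y k by (simp add: slice_def)
    also have "\<dots> = (\<Sum>i=1..n. c i * slice_compl n y i)"
      unfolding sum_subtractf[symmetric]
      by (intro sum.cong) (auto simp: slice_compl_def algebra_simps)
    finally show ?thesis .
  qed
  have "(\<Sum>y\<in>slice n (n - k). (f' y - (\<Sum>i=1..n. c' i * y i))\<^sup>2)
      = (\<Sum>y\<in>slice n (n - k). (f (slice_compl n y) - (\<Sum>i=1..n. c i * slice_compl n y i))\<^sup>2)"
    by (intro sum.cong refl) (simp only: f'_def lin)
  also have "\<dots> = (\<Sum>x\<in>slice n k. (f x - (\<Sum>i=1..n. c i * x i))\<^sup>2)"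
    by (rule sum_slice_compl[OF kn])
  finally have err': "(\<Sum>y\<in>slice n (n - k). (f' y - (\<Sum>i=1..n. c' i * y i))\<^sup>2) \<le> \<epsilon> * real (n choose (n - k))"
    using err sym by simp
  have k': "2 \<le> n - k" "2 * (n - k) \<le> n" using k by auto
  obtain S where S: "S \<subseteq> {1..n}"
      "real (card S) \<le> max 1 (fkn_const * sqrt \<epsilon> / (real (n - k) / real n))"
    and app: "(\<Sum>y\<in>slice n (n - k). (f' y - max_coord S y)\<^sup>2) \<le> fkn_const * \<epsilon> * real (n choose (n - k)) \<or>
     (\<Sum>y\<in>slice n (n - k). ((1 - f' y) - max_coord S y)\<^sup>2) \<le> fkn_const * \<epsilon> * real (n choose (n - k))"
    by (rule max_coord_approx[OF k' f' err' small])
  have max: "max_coord S y = 1 - min_coord S (slice_compl n y)" if y: "y \<in> slice n (n - k)" for y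
  proof -
    have "slice_compl n y \<in> slice n k" using slice_compl_mem[OF y] kn by simp
    from max_coord_slice_compl[OF S(1) this kn] show ?thesis by (simp add: slice_compl_compl[OF y])
  qed
  have "(\<Sum>y\<in>slice n (n - k). (f' y - max_coord S y)\<^sup>2)
      = (\<Sum>y\<in>slice n (n - k). ((1 - f (slice_compl n y)) - min_coord S (slice_compl n y))\<^sup>2)"
    by (intro sum.cong refl) (simp add: f'_def max power2_eq_square algebra_simps)
  also have "\<dots> = (\<Sum>x\<in>slice n k. ((1 - f x) - min_coord S x)\<^sup>2)"
    by (rule sum_slice_compl[OF kn])
  finally have 1: "(\<Sum>y\<in>slice n (n - k). (f' y - max_coord S y)\<^sup>2)
      = (\<Sum>x\<in>slice n k. ((1 - f x) - min_coord S x)\<^sup>2)" .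
  have "(\<Sum>y\<in>slice n (n - k). ((1 - f' y) - max_coord S y)\<^sup>2)
      = (\<Sum>y\<in>slice n (n - k). (f (slice_compl n y) - min_coord S (slice_compl n y))\<^sup>2)"
    by (intro sum.cong refl) (simp add: f'_def max power2_eq_square algebra_simps)
  also have "\<dots> = (\<Sum>x\<in>slice n k. (f x - min_coord S x)\<^sup>2)"
    by (rule sum_slice_compl[OF kn])
  finally have 2: "(\<Sum>y\<in>slice n (n - k). ((1 - f' y) - max_coord S y)\<^sup>2)
      = (\<Sum>x\<in>slice n k. (f x - min_coord S x)\<^sup>2)" .
  have "real (n - k) / real n = 1 - real k / real n"
    using k by (simp add: of_nat_diff field_simps)
  then show ?thesis using S app unfolding 1 2 sym by (intro that[of S]) auto
qed

theorem theorem2: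
  shows "\<exists>C::real. C > 0 \<and>
    (\<forall>(n::nat) (k::nat) (f :: (nat \<Rightarrow> real) \<Rightarrow> real) (\<epsilon>::real) (c :: nat \<Rightarrow> real).
      2 \<le> k \<longrightarrow> k + 2 \<le> n \<longrightarrow>
      f \<in> slice n k \<rightarrow> {0, 1} \<longrightarrow>
      slice_sqnorm n k (\<lambda>x. f x - (\<Sum>i=1..n. c i * x i)) \<le> \<epsilon> \<longrightarrow>
      (let p = min (real k / real n) (1 - real k / real n) in
        \<exists>S. S \<subseteq> {1..n} \<and> real (card S) \<le> max 1 (C * sqrt \<epsilon> / p) \<and>
          (real k \<le> real n / 2 \<longrightarrow>
             slice_sqnorm n k (\<lambda>x. f x - max_coord S x) \<le> C * \<epsilon> \<or>
             slice_sqnorm n k (\<lambda>x. (1 - f x) - max_coord S x) \<le> C * \<epsilon>) \<and>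
          (real k \<ge> real n / 2 \<longrightarrow>
             slice_sqnorm n k (\<lambda>x. f x - min_coord S x) \<le> C * \<epsilon> \<or>
             slice_sqnorm n k (\<lambda>x. (1 - f x) - min_coord S x) \<le> C * \<epsilon>)))"
proof (intro exI[of _ "fkn_const\<^sup>2"] conjI allI impI)
  let ?A = fkn_const
  have A1: "1 \<le> ?A" by (rule fkn_const_ge_1)
  then show "?A\<^sup>2 > 0" by simp
  \<comment> \<open>The constant is squared for the sake of the middle slice: there
    \<open>fkn_const * sqrt \<epsilon> < 1\<close> is wanted, that is,
    \<open>fkn_const^2 * \<epsilon> < 1\<close>.\<close>
  have AA: "?A \<le> ?A\<^sup>2" using A1 by (simp add: power2_eq_square)
  fix n k :: nat and f :: "(nat \<Rightarrow> real) \<Rightarrow> real" and \<epsilon> :: real and c :: "nat \<Rightarrow> real"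
  assume k: "2 \<le> k" "k + 2 \<le> n" and f: "f \<in> slice n k \<rightarrow> {0, 1}"
    and norm: "slice_sqnorm n k (\<lambda>x. f x - (\<Sum>i=1..n. c i * x i)) \<le> \<epsilon>"
  let ?C = "real (n choose k)"
  define p where "p = min (real k / real n) (1 - real k / real n)"
  have kn: "k \<le> n" using k by simp
  have C: "?C > 0" using kn by simp
  have err: "(\<Sum>x\<in>slice n k. (f x - (\<Sum>i=1..n. c i * x i))\<^sup>2) \<le> \<epsilon> * ?C"
    using norm by (simp only: slice_sqnorm_le_iff[OF kn])
  have "0 \<le> \<epsilon> * ?C" by (rule order_trans[OF _ err]) (simp add: sum_nonneg)
  then have \<epsilon>0: "0 \<le> \<epsilon>" using C by (simp add: zero_le_mult_iff)
  have p0: "0 < p" using k by (simp add: p_def)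
  have bound: "y \<le> ?A * \<epsilon> * ?C \<Longrightarrow> y \<le> ?A\<^sup>2 * \<epsilon> * ?C" for y
    using AA \<epsilon>0 C by (meson mult_right_mono order_trans less_imp_le)
  have card_bound: "real (card S) \<le> max 1 (?A\<^sup>2 * sqrt \<epsilon> / p)"
    if "real (card S) \<le> max 1 (?A * sqrt \<epsilon> / p)" for S :: "nat set"
  proof -
    have "?A * sqrt \<epsilon> / p \<le> ?A\<^sup>2 * sqrt \<epsilon> / p"
      using AA \<epsilon>0 p0 by (intro divide_right_mono mult_right_mono) auto
    then show ?thesis using that by linarith
  qed
  have "\<exists>S. S \<subseteq> {1..n} \<and> real (card S) \<le> max 1 (?A\<^sup>2 * sqrt \<epsilon> / p) \<and>
    (real k \<le> real n / 2 \<longrightarrow>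
      (\<Sum>x\<in>slice n k. (f x - max_coord S x)\<^sup>2) \<le> ?A\<^sup>2 * \<epsilon> * ?C \<or>
      (\<Sum>x\<in>slice n k. ((1 - f x) - max_coord S x)\<^sup>2) \<le> ?A\<^sup>2 * \<epsilon> * ?C) \<and>
    (real k \<ge> real n / 2 \<longrightarrow>
      (\<Sum>x\<in>slice n k. (f x - min_coord S x)\<^sup>2) \<le> ?A\<^sup>2 * \<epsilon> * ?C \<or>
      (\<Sum>x\<in>slice n k. ((1 - f x) - min_coord S x)\<^sup>2) \<le> ?A\<^sup>2 * \<epsilon> * ?C)"
  proof (cases "?A\<^sup>2 * \<epsilon> < 1")
    case False
    have "(\<Sum>x\<in>slice n k. (f x)\<^sup>2) \<le> 1 * ?C" using sqnorm_boolean_le[OF f] by simp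
    also have "\<dots> \<le> ?A\<^sup>2 * \<epsilon> * ?C" using False C by (intro mult_right_mono) auto
    \<comment> \<open>By the conventions for \<open>{}\<close> the maximum is 0 and the minimum is
      1, so \<open>f - 0\<close> and \<open>(1 - f) - 1\<close> both have the square of
      \<open>f\<close>.\<close>
    finally show ?thesis by (intro exI[of _ "{}"]) (simp add: max_coord_def min_coord_def)
  next
    case True
    have small: "?A * \<epsilon> < 1" using True AA \<epsilon>0 by (meson mult_right_mono le_less_trans)
    consider "2 * k < n" | "2 * k = n" | "2 * k > n" by linarith
    then show ?thesis
    proof cases
      case 1
      have pk: "p = real k / real n" using 1 k by (simp add: p_def field_simps)
      have "2 * k \<le> n" using 1 by simp
      then obtain S where S: "S \<subseteq> {1..n}" "real (card S) \<le> max 1 (?A * sqrt \<epsilon> / (real k / real n))"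
        "(\<Sum>x\<in>slice n k. (f x - max_coord S x)\<^sup>2) \<le> ?A * \<epsilon> * ?C \<or>
         (\<Sum>x\<in>slice n k. ((1 - f x) - max_coord S x)\<^sup>2) \<le> ?A * \<epsilon> * ?C"
        using max_coord_approx[OF k(1) _ f err small] by blast
      have "\<not> real k \<ge> real n / 2" using 1 by linarith
      then show ?thesis using S bound card_bound[of S] unfolding pk by blast
    next
      case 3
      have pk: "p = 1 - real k / real n" using 3 k by (simp add: p_def field_simps)
      have "n \<le> 2 * k" using 3 by simp
      then obtain S where S: "S \<subseteq> {1..n}" "real (card S) \<le> max 1 (?A * sqrt \<epsilon> / (1 - real k / real n))"
        "(\<Sum>x\<in>slice n k. (f x - min_coord S x)\<^sup>2) \<le> ?A * \<epsilon> * ?C \<or>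
         (\<Sum>x\<in>slice n k. ((1 - f x) - min_coord S x)\<^sup>2) \<le> ?A * \<epsilon> * ?C"
        using min_coord_approx[OF k(2) _ f err small] by blast
      have "\<not> real k \<le> real n / 2" using 3 by linarith
      then show ?thesis using S bound card_bound[of S] unfolding pk by blast
    next
      case 2
      have half: "real k / real n = 1 / 2" using 2 k by (simp add: field_simps)
      have pk: "p = real k / real n" by (simp add: p_def half)
      have "2 * k \<le> n" using 2 by simp
      then obtain S where S: "S \<subseteq> {1..n}" "real (card S) \<le> max 1 (?A * sqrt \<epsilon> / (real k / real n))"
        "(\<Sum>x\<in>slice n k. (f x - max_coord S x)\<^sup>2) \<le> ?A * \<epsilon> * ?C \<or>
         (\<Sum>x\<in>slice n k. ((1 - f x) - max_coord S x)\<^sup>2) \<le> ?A * \<epsilon> * ?C"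
        using max_coord_approx[OF k(1) _ f err small] by blast
      \<comment> \<open>At \<open>k = n / 2\<close> one \<open>S\<close> must serve for both the
        maximum and the minimum. As \<open>p = 1 / 2\<close>, the size bound is below 2: for a
        singleton the two functions coincide, and for \<open>{}\<close> the alternatives for
        \<open>f\<close> and \<open>1 - f\<close> change places.\<close>
      have "(?A * sqrt \<epsilon>)\<^sup>2 < 1\<^sup>2" using True \<epsilon>0 by (simp add: power_mult_distrib)
      then have "?A * sqrt \<epsilon> < 1" by (rule power2_less_imp_less) simp
      then have "real (card S) < 2" using S(2) unfolding half by simp
      moreover have "finite S" using S(1) finite_subset by blast
      ultimately consider "S = {}" | i where "S = {i}"
        by (metis card_1_singletonE card_0_eq less_2_cases of_nat_less_iff of_nat_numeral One_nat_def)
      then have "(\<Sum>x\<in>slice n k. (f x - min_coord S x)\<^sup>2) \<le> ?A * \<epsilon> * ?C \<or>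
         (\<Sum>x\<in>slice n k. ((1 - f x) - min_coord S x)\<^sup>2) \<le> ?A * \<epsilon> * ?C"
      proof cases
        case 1
        then have "min_coord S x = 1" "max_coord S x = 0" for x
          by (simp_all add: min_coord_def max_coord_def)
        then show ?thesis using S(3) by (auto simp: power2_commute[of 1])
      next
        case 2
        then have "min_coord S x = max_coord S x" for x
          by (simp add: min_coord_def max_coord_def)
        then show ?thesis using S(3) by simp
      qed
      then show ?thesis using S bound card_bound[of S] unfolding pk by blast
    qed
  qed
  then show "let p = min (real k / real n) (1 - real k / real n) in
    \<exists>S. S \<subseteq> {1..n} \<and> real (card S) \<le> max 1 (?A\<^sup>2 * sqrt \<epsilon> / p) \<and>
      (real k \<le> real n / 2 \<longrightarrow>
         slice_sqnorm n k (\<lambda>x. f x - max_coord S x) \<le> ?A\<^sup>2 * \<epsilon> \<or>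
         slice_sqnorm n k (\<lambda>x. (1 - f x) - max_coord S x) \<le> ?A\<^sup>2 * \<epsilon>) \<and>
      (real k \<ge> real n / 2 \<longrightarrow>
         slice_sqnorm n k (\<lambda>x. f x - min_coord S x) \<le> ?A\<^sup>2 * \<epsilon> \<or>
         slice_sqnorm n k (\<lambda>x. (1 - f x) - min_coord S x) \<le> ?A\<^sup>2 * \<epsilon>)"
    unfolding Let_def p_def slice_sqnorm_le_iff[OF kn] .
qed

end
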